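(* Let $f_1,\dots,f_m:\mathbb{R}^d\to\mathbb{R}$ each be convex and $L$-smooth, and let $x^\star$ be an optimal solution of $\min_{x\in\mathbb{R}^d}\frac1m\sum_{i=1}^m f_i(x)$; put $X^\star=1(x^\star)^\top$. Let $A\in\mathbb{R}^{m\times m}$, $B,C\in\mathbb{S}^m$ satisfy: (i) $A=BD$ with $B\succeq0$ and $0\prec D\in\mathbb{S}^m$; (ii) $D1=1$ and $1^\top B=1^\top$; (iii) $C\succeq0$ and $\mathrm{Null}(C)=\mathrm{span}(1)$; (iv) $B$ and $C$ commute; (v) $I-\frac12C-\sqrt B D\sqrt B\succeq0$ (equivalently $I-\frac12C-A\succeq0$, if $B$ commutes with $D$). Let $X^0\in\mathbb{R}^{m\times d}$, $Y^0=0$, and let $\{(X^k,Y^k)\}$ be generated, with stepsize $0<\gamma\le\lambda_{\min}(D)/L$, by $$X^{k+1}=AX^k-\gamma B\nabla f(X^k)-Y^k,\qquad Y^{k+1}=Y^k+CX^{k+1}.$$ Let $\widehat X^k=\frac1k\sum_{t=1}^kX^t$ and $M(X)=\max\big\{\|(I-J)X\|\,\|\nabla f(X^\star)\|,\;|f(X)-f(X^\star)|\big\}$. In this setting the bound $$M(\widehat X^k)\le\frac1k\left(\frac1{2\gamma}\|X^0-X^\star\|_D^2+2\gamma\,\frac{\rho(B-J)}{\lambda_2(C)}\,\|\nabla f(X^\star)\|^2\right)$$ holds, and the stepsize that minimizes its right-hand side is $$\gamma=\min\left(\frac{\lambda_{\min}(D)}{L},\;\frac12\sqrt{\frac{\lambda_2(C)}{\rho(B-J)}}\,\frac{\|X^0-X^\star\|_D}{\|\nabla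 f(X^\star)\|}\right),$$ leading to the sublinear rate $$M(\widehat X^k)\le\frac1k\max\left\{\frac{L\|X^0-X^\star\|_D^2}{\lambda_{\min}(D)},\;2\sqrt{\frac{\rho(B-J)}{\lambda_2(C)}}\,\|X^0-X^\star\|_D\,\|\nabla f(X^\star)\|\right\}.$$
   Context: $\mathbb{S}^m$ is the set of real symmetric $m\times m$ matrices; $\preceq,\prec$ denote the Loewner order. $1\in\mathbb{R}^m$ is the all-ones vector and $J=\frac1m11^\top$. For $X=[x_1,\dots,x_m]^\top\in\mathbb{R}^{m\times d}$ (row $i$ is $x_i^\top$), $f(X)=\sum_{i=1}^m f_i(x_i)$ and $\nabla f(X)=[\nabla f_1(x_1),\dots,\nabla f_m(x_m)]^\top$. "$L$-smooth" means differentiable with $L$-Lipschitz gradient. $\|\cdot\|$ is the Frobenius norm and $\|X\|_D^2=\mathrm{tr}(X^\top DX)$. $\rho(\cdot)$ is the spectral radius, $\lambda_{\min}$ the smallest eigenvalue, and $\lambda_2(C)$ the second smallest eigenvalue of $C$. *)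

theory Defs
  imports "HOL-Analysis.Analysis"
begin

definition symmetric_mat :: "real^'n^'n \<Rightarrow> bool" where
  "symmetric_mat M \<longleftrightarrow> transpose M = M"

definition psd :: "real^'n^'n \<Rightarrow> bool" where
  "psd M \<longleftrightarrow> symmetric_mat M \<and> (\<forall>v. 0 \<le> v \<bullet> (M *v v))"

definition pd :: "real^'n^'n \<Rightarrow> bool" where
  "pd M \<longleftrightarrow> symmetric_mat M \<and> (\<forall>v. v \<noteq> 0 \<longrightarrow> 0 < v \<bullet> (M *v v))"

text \<open>The square root is only meaningful for positive semidefinite matrices, where it exists
  and is unique.\<close>

definition psd_sqrt :: "real^'n^'n \<Rightarrow> real^'n^'n" where
  "psd_sqrt M = (THE S. psd S \<and> S ** S = M)"

definition spectrum :: "'a::field^'n^'n \<Rightarrow> 'a set" where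
  "spectrum M = {z. \<exists>v. v \<noteq> 0 \<and> M *v v = z *s v}"

definition spectral_radius :: "real^'n^'n \<Rightarrow> real" where
  "spectral_radius M = Max (cmod ` spectrum (map_matrix complex_of_real M))"

definition lambda_min :: "real^'n^'n \<Rightarrow> real" where
  "lambda_min M = Min (spectrum M)"

text \<open>The real eigenvalues in increasing order, each repeated according to the dimension of its
  eigenspace. For a symmetric matrix this dimension is also the algebraic multiplicity, and the
  list has length \<^term>\<open>CARD('n)\<close>.\<close>

definition sorted_eigenvalues :: "real^'n^'n \<Rightarrow> real list" where
  "sorted_eigenvalues M =
     sorted_list_of_multiset (\<Sum>z\<in>spectrum M. replicate_mset (dim {v. M *v v = z *s v}) z)"

text \<open>List positions count from 0.\<close>

definition lambda2 :: "real^'n^'n \<Rightarrow> real" where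
  "lambda2 M = sorted_eigenvalues M ! 1"

definition averaging_mat :: "real^'n^'n" where
  "averaging_mat = (\<chi> i j. 1 / real CARD('n))"

definition gradient :: "('a::euclidean_space \<Rightarrow> real) \<Rightarrow> 'a \<Rightarrow> 'a" where
  "gradient f x = (THE D. GDERIV f x :> D)"

definition smooth :: "real \<Rightarrow> ('a::euclidean_space \<Rightarrow> real) \<Rightarrow> bool" where
  "smooth L f \<longleftrightarrow> (\<forall>x. f differentiable (at x)) \<and> L-lipschitz_on UNIV (gradient f)"

text \<open>An element \<open>X\<close> of \<^typ>\<open>real^'d^'m\<close> is an \<open>m \<times> d\<close> matrix whose row \<open>X $ i\<close> is the local
  variable of agent \<open>i\<close>. The library norm on this type is the Frobenius norm.\<close>

definition stacked_fun :: "('m::finite \<Rightarrow> real^'d \<Rightarrow> real) \<Rightarrow> real^'d^'m \<Rightarrow> real" where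
  "stacked_fun f X = (\<Sum>i\<in>UNIV. f i (X $ i))"

definition stacked_grad :: "('m::finite \<Rightarrow> real^'d \<Rightarrow> real) \<Rightarrow> real^'d^'m \<Rightarrow> real^'d^'m" where
  "stacked_grad f X = (\<chi> i. gradient (f i) (X $ i))"

definition consensual :: "real^'d \<Rightarrow> real^'d^'m" where
  "consensual x = (\<chi> i. x)"

definition weighted_norm :: "real^'m^'m \<Rightarrow> real^'d^'m \<Rightarrow> real" where
  "weighted_norm D X = sqrt (trace (transpose X ** D ** X))"

definition ABC_iterates ::
  "real^'m^'m \<Rightarrow> real^'m^'m \<Rightarrow> real^'m^'m \<Rightarrow> ('m::finite \<Rightarrow> real^'d \<Rightarrow> real) \<Rightarrow> real \<Rightarrow> real^'d^'m
    \<Rightarrow> (nat \<Rightarrow> real^'d^'m) \<Rightarrow> (nat \<Rightarrow> real^'d^'m) \<Rightarrow> bool" where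
  "ABC_iterates A B C f \<gamma> X0 X Y \<longleftrightarrow>
     X 0 = X0 \<and> Y 0 = 0 \<and>
     (\<forall>k. X (Suc k) = A ** X k - \<gamma> *\<^sub>R (B ** stacked_grad f (X k)) - Y k) \<and>
     (\<forall>k. Y (Suc k) = Y k + C ** X (Suc k))"

definition running_average :: "(nat \<Rightarrow> real^'d^'m) \<Rightarrow> nat \<Rightarrow> real^'d^'m" where
  "running_average X k = (1 / real k) *\<^sub>R (\<Sum>t=1..k. X t)"

definition merit :: "('m::finite \<Rightarrow> real^'d \<Rightarrow> real) \<Rightarrow> real^'d^'m \<Rightarrow> real^'d^'m \<Rightarrow> real" where
  "merit f Xs X =
     max (norm ((mat 1 - averaging_mat) ** X) * norm (stacked_grad f Xs))
         \<bar>stacked_fun f X - stacked_fun f Xs\<bar>"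

text \<open>The right-hand side of the rate for stepsize \<open>\<gamma>\<close>, where \<open>R\<close> is the weighted distance of
  the initial point to the solution, \<open>G\<close> the norm of the gradient at the solution, and
  \<open>\<rho>\<close>, \<open>\<mu>\<close> stand for \<open>\<rho>(B - J)\<close> and \<open>\<lambda>\<^sub>2(C)\<close>.\<close>

definition rate_bound :: "real \<Rightarrow> real \<Rightarrow> real \<Rightarrow> real \<Rightarrow> nat \<Rightarrow> real \<Rightarrow> real" where
  "rate_bound R G \<rho> \<mu> k \<gamma> = 1 / real k * (1 / (2 * \<gamma>) * R\<^sup>2 + 2 * \<gamma> * (\<rho> / \<mu>) * G\<^sup>2)"

text \<open>If \<open>\<rho> = 0\<close> or \<open>G = 0\<close> then the second argument of the minimum has a vanishing denominator
  and is read as \<open>+\<infinity>\<close>; division by zero in HOL would instead make it 0.\<close>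

definition optimal_stepsize :: "real \<Rightarrow> real \<Rightarrow> real \<Rightarrow> real \<Rightarrow> real \<Rightarrow> real" where
  "optimal_stepsize \<gamma>max R G \<rho> \<mu> =
     (if \<rho> = 0 \<or> G = 0 then \<gamma>max else min \<gamma>max (1 / 2 * sqrt (\<mu> / \<rho>) * (R / G)))"

end

theory Submission
  imports Defs
begin

text \<open>Every iterate after the first is \<open>X\<^sup>k\<^sup>+\<^sup>1 = B Z\<^sup>k\<^sup>+\<^sup>1\<close> and \<open>Y\<^sup>k = B C W\<^sup>k\<close>, where \<open>W\<^sup>k = Z\<^sup>1 + \<dots> + Z\<^sup>k\<close> and
  \<open>Z\<^sup>k\<^sup>+\<^sup>1 = D X\<^sup>k - \<gamma> \<nabla>f(X\<^sup>k) - C W\<^sup>k\<close>. Solving the last equation for \<open>\<gamma> \<nabla>f(X\<^sup>k)\<close> and inserting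
  it into the descent inequality, condition (v) tested on \<open>\<surd>B Z\<^sup>k\<^sup>+\<^sup>1\<close> makes
  \<open>2\<gamma>(f(X\<^sup>k\<^sup>+\<^sup>1) - f(X\<^sup>\<star>))\<close> at most the decrease of \<open>\<parallel>X\<^sup>k - X\<^sup>\<star>\<parallel>\<^sub>D\<^sup>2 + \<langle>W\<^sup>k, B C W\<^sup>k\<rangle>\<close>. Summing and
  using Jensen's inequality for the running average \<open>X\<^sub>k\<close> leaves \<open>2\<gamma>k(f(X\<^sub>k) - f(X\<^sup>\<star>)) \<le> \<parallel>X\<^sup>0 - X\<^sup>\<star>\<parallel>\<^sub>D\<^sup>2 - \<langle>W\<^sup>k, B C W\<^sup>k\<rangle>\<close>, where the
  last form controls the disagreement because \<open>k X\<^sub>k = B W\<^sup>k\<close> and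
  \<open>\<parallel>(I - J) B W\<parallel>\<^sup>2 \<le> (\<rho>/\<mu>) \<langle>W, B C W\<rangle>\<close>. As \<open>f(X\<^sub>k) - f(X\<^sup>\<star>)\<close> is at least
  \<open>-\<parallel>\<nabla>f(X\<^sup>\<star>)\<parallel> \<parallel>(I - J) X\<^sub>k\<parallel>\<close>, the AM-GM inequality gives the bound.\<close>

section \<open>Symmetric matrices\<close>

lemma symmetric_mat_inner:
  fixes M :: "real^'n^'n"
  assumes "symmetric_mat M"
  shows "(M *v x) \<bullet> y = x \<bullet> (M *v y)"
  using assms unfolding symmetric_mat_def
  by (metis dot_lmul_matrix transpose_matrix_vector)

lemma symmetric_mat_iff_inner:
  fixes M :: "real^'n^'n"
  shows "symmetric_mat M \<longleftrightarrow> (\<forall>x y. (M *v x) \<bullet> y = x \<bullet> (M *v y))"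
proof
  show "symmetric_mat M" if "\<forall>x y. (M *v x) \<bullet> y = x \<bullet> (M *v y)"
    unfolding symmetric_mat_def matrix_eq
  proof
    fix x
    have "(transpose M *v x) \<bullet> y = (M *v x) \<bullet> y" for y
      by (simp add: dot_lmul_matrix that)
    then show "transpose M *v x = M *v x"
      using vector_eq_rdot by blast
  qed
qed (simp add: symmetric_mat_inner)

text \<open>Moving from \<open>v\<close> in the direction \<open>- M *v v\<close> changes the form
  at first order by a negative multiple of the squared norm of \<open>M *v v\<close>, so a zero of a
  nonnegative form must be a kernel vector. Restricting to an invariant subspace keeps the perturbed
  vector inside the region of nonnegativity.\<close>

lemma psd_zero_form_imp_kernel:
  fixes M :: "real^'n^'n"
  assumes sym: "symmetric_mat M"
    and S: "subspace S" "\<And>x. x \<in> S \<Longrightarrow> M *v x \<in> S"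
    and nonneg: "\<And>x. x \<in> S \<Longrightarrow> 0 \<le> x \<bullet> (M *v x)"
    and v: "v \<in> S" "v \<bullet> (M *v v) = 0"
  shows "M *v v = 0"
proof (rule ccontr)
  assume ne: "M *v v \<noteq> 0"
  define w where "w = M *v v"
  define a where "a = w \<bullet> w"
  define b where "b = w \<bullet> (M *v w)"
  have a: "a > 0" using ne by (simp add: a_def w_def)
  have w: "w \<in> S" using S v w_def by blast
  then have b: "b \<ge> 0" using nonneg b_def by blast
  \<comment> \<open>Any \<open>t > 0\<close> with \<open>t * b < 2 * a\<close> contradicts
    nonnegativity; the \<open>+ 1\<close> covers \<open>b = 0\<close>.\<close>
  define t where "t = a / (b + 1)"
  have t: "t > 0" using a b by (simp add: t_def)
  have "v - t *\<^sub>R w \<in> S"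
    using S(1) v(1) w by (simp add: subspace_diff subspace_scale)
  then have "0 \<le> (v - t *\<^sub>R w) \<bullet> (M *v (v - t *\<^sub>R w))" by (rule nonneg)
  also have "\<dots> = t * (t * b - 2 * a)"
    using v(2) symmetric_mat_inner[OF sym, of v w]
    by (simp add: a_def b_def w_def[symmetric] matrix_vector_mult_diff_distrib
        matrix_vector_mult_scaleR inner_diff_left inner_diff_right algebra_simps inner_commute)
  finally have "2 * a \<le> t * b" using t by (simp add: zero_le_mult_iff)
  also have "t * b \<le> a" using a b by (simp add: t_def field_simps)
  finally show False using a by simp
qed

text \<open>If \<open>c\<close> is the minimum of the form on the unit sphere of \<open>S\<close>,
  then \<open>M - c *\<^sub>R mat 1\<close> is nonnegative on \<open>S\<close> and its form vanishes
  at the minimizer, which is therefore a kernel vector. The subspace is free because the spectral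
  theorem, \<open>lambda_min\<close> and \<open>lambda2\<close> use different ones.\<close>

lemma rayleigh_min_eigenvector:
  fixes M :: "real^'n^'n"
  assumes sym: "symmetric_mat M"
    and S: "subspace S" "\<And>x. x \<in> S \<Longrightarrow> M *v x \<in> S" "S \<noteq> {0}"
  obtains v c where "v \<in> S" "v \<noteq> 0" "M *v v = c *s v"
    "\<forall>w\<in>S. c * (w \<bullet> w) \<le> w \<bullet> (M *v w)"
proof -
  let ?K = "S \<inter> sphere 0 1"
  let ?q = "\<lambda>w. w \<bullet> (M *v w)"
  have normed: "(1 / norm x) *\<^sub>R x \<in> ?K" if "x \<in> S" "x \<noteq> 0" for x
    using that S(1) by (simp add: subspace_scale)
  obtain x where "x \<in> S" "x \<noteq> 0" using S(1,3) subspace_0 by blast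
  then have ne: "?K \<noteq> {}" using normed by blast
  have comp: "compact ?K"
    by (simp add: S(1) closed_Int_compact closed_subspace)
  have cont: "continuous_on ?K ?q"
    by (intro continuous_intros linear_continuous_on_compose[OF continuous_on_id])
       simp
  obtain v where v: "v \<in> ?K" and min: "\<And>w. w \<in> ?K \<Longrightarrow> ?q v \<le> ?q w"
    using continuous_attains_inf[OF comp ne cont] by blast
  define c where "c = ?q v"
  have bound: "c * (w \<bullet> w) \<le> ?q w" if w: "w \<in> S" for w
  proof (cases "w = 0")
    case False
    have "c \<le> ?q ((1 / norm w) *\<^sub>R w)"
      using min normed w False c_def by blast
    also have "\<dots> = ?q w / (norm w)\<^sup>2"
      by (simp add: matrix_vector_mult_scaleR power2_eq_square)
    finally show ?thesis
      using False by (simp add: field_simps power2_norm_eq_inner)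
  qed simp
  define N where "N = M - c *\<^sub>R mat 1"
  have N: "N *v x = M *v x - c *\<^sub>R x" for x
    by (simp add: N_def matrix_vector_mult_diff_rdistrib flip: scaleR_matrix_vector_assoc)
  have "N *v v = 0"
  proof (rule psd_zero_form_imp_kernel)
    show "symmetric_mat N"
      using sym by (simp add: symmetric_mat_iff_inner N inner_diff_left inner_diff_right)
    show "subspace S" by fact
    show "N *v x \<in> S" if "x \<in> S" for x
      using that S by (simp add: N subspace_diff subspace_scale)
    show "0 \<le> x \<bullet> (N *v x)" if "x \<in> S" for x
      using bound[OF that] by (simp add: N inner_diff_right)
    show "v \<in> S" using v by simp
    show "v \<bullet> (N *v v) = 0"
      using v by (simp add: N inner_diff_right c_def norm_eq_1)
  qed
  then have "M *v v = c *s v" by (simp add: N scalar_mult_eq_scaleR)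
  moreover have "v \<noteq> 0" using v by auto
  ultimately show thesis using that v bound by blast
qed

section \<open>Spectral theorem for real symmetric matrices\<close>

lemma eigenvectors_orthogonal:
  fixes M :: "real^'n^'n"
  assumes "symmetric_mat M" "M *v v = a *s v" "M *v w = b *s w" "a \<noteq> b"
  shows "v \<bullet> w = 0"
proof -
  have "a * (v \<bullet> w) = b * (v \<bullet> w)"
    using symmetric_mat_inner[OF assms(1), of v w] assms(2,3)
    by (simp add: scalar_mult_eq_scaleR)
  then show ?thesis using assms(4) by simp
qed

text \<open>One eigenvector per eigenvalue gives an orthogonal, hence independent, family.
  Finiteness is what gives \<open>Min\<close>, \<open>Max\<close> and the sum over the spectrum in
  the definitions their meaning.\<close>

lemma finite_spectrum_symmetric:
  fixes M :: "real^'n^'n"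
  assumes "symmetric_mat M"
  shows "finite (spectrum M)"
proof -
  have "\<forall>z\<in>spectrum M. \<exists>v. v \<noteq> 0 \<and> M *v v = z *s v"
    by (simp add: spectrum_def)
  then obtain e where e: "\<And>z. z \<in> spectrum M \<Longrightarrow> e z \<noteq> 0 \<and> M *v e z = z *s e z"
    by metis
  have orth: "e a \<bullet> e b = 0" if "a \<in> spectrum M" "b \<in> spectrum M" "a \<noteq> b" for a b
    using eigenvectors_orthogonal[OF assms] e that by blast
  have inj: "inj_on e (spectrum M)"
    using orth e by (metis inj_onI inner_eq_zero_iff)
  have "independent (e ` spectrum M)"
  proof (rule pairwise_orthogonal_independent)
    show "pairwise orthogonal (e ` spectrum M)"
      by (auto simp: pairwise_def orthogonal_def intro!: orth)
    show "0 \<notin> e ` spectrum M" using e by force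
  qed
  then have "finite (e ` spectrum M)" by (simp add: independent_imp_finite)
  then show ?thesis using inj finite_imageD by blast
qed

text \<open>The orthogonal complement of all eigenvectors is invariant under \<open>M\<close>. Were
  it nontrivial, it would contain an eigenvector, which would be orthogonal to itself.\<close>

lemma span_eigenvectors_symmetric:
  fixes M :: "real^'n^'n"
  assumes sym: "symmetric_mat M"
  shows "span {v. \<exists>c. M *v v = c *s v} = UNIV" (is "span ?E = _")
proof (rule ccontr)
  assume ne: "span ?E \<noteq> UNIV"
  define S where "S = {y. \<forall>x\<in>?E. orthogonal x y}"
  have sub: "subspace S" unfolding S_def by (rule subspace_orthogonal_to_vectors)
  have inv: "M *v x \<in> S" if "x \<in> S" for x
  proof -
    have "e \<bullet> (M *v x) = 0" if e: "M *v e = c *s e" for e c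
    proof -
      have "e \<bullet> x = 0" using \<open>x \<in> S\<close> e unfolding S_def orthogonal_def by blast
      then show ?thesis
        using symmetric_mat_inner[OF sym, of e x] e by (simp add: scalar_mult_eq_scaleR)
    qed
    then show ?thesis unfolding S_def orthogonal_def by blast
  qed
  have "span ?E \<subset> UNIV" using ne by auto
  then obtain x where x: "x \<noteq> 0" "\<And>y. y \<in> span ?E \<Longrightarrow> orthogonal x y"
    using orthogonal_to_subspace_exists_gen[of ?E UNIV] by auto
  then have "x \<in> S" unfolding S_def by (auto simp: span_base orthogonal_commute)
  then have "S \<noteq> {0}" using x by blast
  then obtain c v where "v \<in> S" "v \<noteq> 0" "M *v v = c *s v"
    using rayleigh_min_eigenvector[OF sym sub inv] by metis
  then show False unfolding S_def orthogonal_def by fastforce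
qed

text \<open>The basis is the union of orthonormal bases of the sets \<open>V c\<close> over all real
  \<open>c\<close>; when \<open>c\<close> is no eigenvalue, \<open>V c\<close> is trivial and
  contributes nothing. Finiteness of the union follows from orthogonality.\<close>

lemma orthonormal_eigenbasis:
  fixes M :: "real^'n^'n"
  assumes sym: "symmetric_mat M"
  obtains E where "finite E" "pairwise orthogonal E" "\<And>e. e \<in> E \<Longrightarrow> norm e = 1"
    "\<And>e. e \<in> E \<Longrightarrow> \<exists>c. M *v e = c *s e" "span E = UNIV"
proof -
  define V where "V c = {v. M *v v = c *s v}" for c
  have sub: "subspace (V c)" for c
    unfolding V_def
    by (auto simp: subspace_def matrix_vector_right_distrib matrix_vector_mult_scaleR
        scalar_mult_eq_scaleR scaleR_right_distrib mult.commute)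
  have "\<exists>F. F \<subseteq> V c \<and> pairwise orthogonal F \<and> (\<forall>x\<in>F. norm x = 1) \<and> span F = V c" for c
    using orthonormal_basis_subspace[OF sub[of c]] by metis
  then obtain F where F: "\<And>c. F c \<subseteq> V c" "\<And>c. pairwise orthogonal (F c)"
    "\<And>c x. x \<in> F c \<Longrightarrow> norm x = 1" "\<And>c. span (F c) = V c"
    by metis
  define E where "E = (\<Union>c. F c)"
  have orth: "pairwise orthogonal E"
    unfolding pairwise_def
  proof (intro ballI impI)
    fix x y assume "x \<in> E" "y \<in> E" "x \<noteq> y"
    then obtain a b where ab: "x \<in> F a" "y \<in> F b" unfolding E_def by blast
    show "orthogonal x y"
    proof (cases "a = b")
      case True
      then show ?thesis using F(2) ab \<open>x \<noteq> y\<close> by (auto simp: pairwise_def)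
    next
      case False
      have "M *v x = a *s x" "M *v y = b *s y" using ab F(1) V_def by blast+
      then show ?thesis
        using eigenvectors_orthogonal[OF sym _ _ False] by (simp add: orthogonal_def)
    qed
  qed
  have norm: "norm e = 1" if "e \<in> E" for e using that F(3) unfolding E_def by blast
  then have "0 \<notin> E" by force
  then have "finite E"
    using orth independent_imp_finite pairwise_orthogonal_independent by blast
  moreover have "V c \<subseteq> span E" for c
    by (metis F(4) E_def UN_upper UNIV_I span_mono)
  then have "{v. \<exists>c. M *v v = c *s v} \<subseteq> span E" unfolding V_def by blast
  then have "span {v. \<exists>c. M *v v = c *s v} \<subseteq> span E"
    by (rule span_minimal) (rule subspace_span)
  then have "span E = UNIV" by (simp add: span_eigenvectors_symmetric[OF sym] top_unique)
  moreover have "\<exists>c. M *v e = c *s e" if "e \<in> E" for e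
    using that F(1) unfolding E_def V_def by blast
  ultimately show thesis using that orth norm by blast
qed

section \<open>Square roots of positive semidefinite matrices\<close>

lemma psd_root_eigenvector:
  fixes S :: "real^'n^'n"
  assumes S: "psd S" and s: "0 \<le> s" and v: "S *v (S *v v) = (s * s) *s v"
  shows "S *v v = s *s v"
proof -
  have sym: "symmetric_mat S" and nonneg: "\<And>x. 0 \<le> x \<bullet> (S *v x)"
    using S by (auto simp: psd_def)
  show ?thesis
  proof (cases "s = 0")
    case True
    then have "(S *v v) \<bullet> (S *v v) = 0"
      using v symmetric_mat_inner[OF sym, of v "S *v v"] by simp
    then show ?thesis using True by simp
  next
    case False
    \<comment> \<open>Since \<open>S ** S - s * s\<close> factors as \<open>(S + s)(S - s)\<close>,
      the vector \<open>w\<close> satisfies \<open>S *v w = - s *s w\<close>; for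
      \<open>s > 0\<close> semidefiniteness leaves only \<open>w = 0\<close>.\<close>
    define w where "w = S *v v - s *s v"
    have "S *v w = - s *s w"
      using v by (simp add: w_def matrix_vector_mult_diff_distrib scalar_mult_eq_scaleR
          matrix_vector_mult_scaleR algebra_simps)
    then have "0 \<le> - s * (w \<bullet> w)"
      using nonneg[of w] by (simp add: scalar_mult_eq_scaleR)
    then have "s * (w \<bullet> w) \<le> 0" by simp
    then have "w \<bullet> w \<le> 0" using s False by (simp add: mult_le_0_iff)
    then have "w = 0" by (metis inner_ge_zero inner_eq_zero_iff order_antisym)
    then show ?thesis by (simp add: w_def)
  qed
qed

lemma matrix_eq_on_spanning:
  fixes M N :: "real^'n^'n"
  assumes "span E = UNIV" "\<And>e. e \<in> E \<Longrightarrow> M *v e = N *v e"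
  shows "M = N"
  unfolding matrix_eq
  using linear_eq_on_span[of "(*v) M" "(*v) N" E] assms by auto

lemma psd_root_exists:
  fixes M :: "real^'n^'n"
  assumes M: "psd M"
  shows "\<exists>S. psd S \<and> S ** S = M"
proof -
  have sym: "symmetric_mat M" using M by (simp add: psd_def)
  obtain E where E: "finite E" "pairwise orthogonal E" "\<And>e. e \<in> E \<Longrightarrow> norm e = 1"
    "\<And>e. e \<in> E \<Longrightarrow> \<exists>c. M *v e = c *s e" "span E = UNIV"
    using orthonormal_eigenbasis[OF sym] by blast
  obtain c where c: "\<And>e. e \<in> E \<Longrightarrow> M *v e = c e *s e" using E(4) by metis
  have c_nonneg: "0 \<le> c e" if "e \<in> E" for e
    using M that c[OF that] E(3)[OF that] unfolding psd_def
    by (metis scalar_mult_eq_scaleR inner_scaleR_right norm_eq_1 mult.right_neutral)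
  \<comment> \<open>The root acts on the orthonormal eigenbasis by the square roots of the
    eigenvalues.\<close>
  define g where "g v = (\<Sum>e\<in>E. (sqrt (c e) * (e \<bullet> v)) *\<^sub>R e)" for v
  have "linear g"
    unfolding g_def
    by (rule linear_compose_sum)
       (auto intro!: linearI simp: inner_add_right algebra_simps)
  then have gS: "matrix g *v v = g v" for v by (simp add: matrix_works)
  have ge: "g e = sqrt (c e) *\<^sub>R e" if e: "e \<in> E" for e
  proof -
    have "g e = (\<Sum>x\<in>E. if x = e then sqrt (c e) *\<^sub>R e else 0)"
      unfolding g_def using E(2,3) e
      by (intro sum.cong) (auto simp: pairwise_def orthogonal_def norm_eq_1)
    then show ?thesis using E(1) e by simp
  qed
  have "psd (matrix g)"
    unfolding psd_def symmetric_mat_iff_inner gS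
  proof (intro conjI allI)
    show "g x \<bullet> y = x \<bullet> g y" for x y
      unfolding g_def inner_sum_left inner_sum_right
      by (intro sum.cong) (auto simp: inner_commute)
    show "0 \<le> v \<bullet> g v" for v
      unfolding g_def inner_sum_right
      by (intro sum_nonneg) (simp add: inner_commute c_nonneg mult.assoc)
  qed
  moreover have "matrix g ** matrix g = M"
    using E(5)
  proof (rule matrix_eq_on_spanning)
    fix e assume e: "e \<in> E"
    have "g (g e) = c e *s e"
      using \<open>linear g\<close> ge[OF e] c_nonneg[OF e]
      by (simp add: linear_cmul scalar_mult_eq_scaleR)
    then show "matrix g ** matrix g *v e = M *v e"
      using c[OF e] by (simp add: gS flip: matrix_vector_mul_assoc)
  qed
  ultimately show ?thesis by blast
qed

text \<open>With \<open>N = 1\<close> this is uniqueness of the square root, with \<open>S = T\<close> it is commutation of the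
  square root with everything that commutes with its square.\<close>

lemma psd_root_commute:
  fixes S T N :: "real^'n^'n"
  assumes S: "psd S" and T: "psd T" and comm: "(S ** S) ** N = N ** (T ** T)"
  shows "S ** N = N ** T"
  using span_eigenvectors_symmetric
proof (rule matrix_eq_on_spanning)
  show "symmetric_mat T" using T by (simp add: psd_def)
  fix e assume "e \<in> {v. \<exists>c. T *v v = c *s v}"
  then obtain c where c: "T *v e = c *s e" by blast
  show "S ** N *v e = N ** T *v e"
  proof (cases "e = 0")
    case False
    have "0 \<le> e \<bullet> (T *v e)" using T by (simp add: psd_def)
    also have "\<dots> = c * (e \<bullet> e)" by (simp add: c scalar_mult_eq_scaleR)
    finally have "0 \<le> c"
      using False by (metis inner_gt_zero_iff not_less zero_le_mult_iff)
    \<comment> \<open>Both sides are compared on eigenvectors of \<open>T\<close>, which span. The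
      commutation hypothesis only speaks of squares; \<open>psd_root_eigenvector\<close> takes the
      root of the eigenvalue \<open>c * c\<close>.\<close>
    have "S *v (S *v (N *v e)) = N *v (T *v (T *v e))"
      using arg_cong[OF comm, of "\<lambda>M. M *v e"] by (simp flip: matrix_vector_mul_assoc)
    also have "\<dots> = (c * c) *s (N *v e)"
      by (simp add: c scalar_mult_eq_scaleR matrix_vector_mult_scaleR)
    finally have "S *v (N *v e) = c *s (N *v e)"
      using psd_root_eigenvector[OF S \<open>0 \<le> c\<close>] by blast
    then show ?thesis
      by (simp add: c scalar_mult_eq_scaleR matrix_vector_mult_scaleR
          flip: matrix_vector_mul_assoc)
  qed simp
qed

lemma psd_sqrt_works:
  fixes M :: "real^'n^'n"
  assumes M: "psd M"
  shows "psd (psd_sqrt M)" "psd_sqrt M ** psd_sqrt M = M"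
proof -
  have "\<exists>!S. psd S \<and> S ** S = M"
  proof (rule ex_ex1I)
    show "\<exists>S. psd S \<and> S ** S = M" using psd_root_exists[OF M] .
    show "S = T" if "psd S \<and> S ** S = M" "psd T \<and> T ** T = M" for S T
      using psd_root_commute[of S T "mat 1"] that by simp
  qed
  then have "psd (psd_sqrt M) \<and> psd_sqrt M ** psd_sqrt M = M"
    unfolding psd_sqrt_def by (rule theI')
  then show "psd (psd_sqrt M)" "psd_sqrt M ** psd_sqrt M = M" by auto
qed

lemma psd_sqrt_commute:
  fixes M N :: "real^'n^'n"
  assumes "psd M" "M ** N = N ** M"
  shows "psd_sqrt M ** N = N ** psd_sqrt M"
  using psd_root_commute[of "psd_sqrt M" "psd_sqrt M" N] psd_sqrt_works[OF assms(1)] assms(2)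
  by simp

lemma psd_sqrt_fixes:
  fixes M :: "real^'n^'n"
  assumes "psd M" "M *v v = v"
  shows "psd_sqrt M *v v = v"
  using psd_root_eigenvector[of "psd_sqrt M" 1 v] psd_sqrt_works[OF assms(1)] assms(2)
  by (simp add: matrix_vector_mul_assoc)

section \<open>Extremal eigenvalues\<close>

lemma symmetric_min_eigenvector:
  fixes M :: "real^'n^'n"
  assumes sym: "symmetric_mat M"
  obtains v c where "v \<noteq> 0" "M *v v = c *s v" "\<forall>w. c * (w \<bullet> w) \<le> w \<bullet> (M *v w)"
proof (rule rayleigh_min_eigenvector[OF sym subspace_UNIV])
  show "(UNIV :: (real^'n) set) \<noteq> {0}" by (metis UNIV_I singletonD zero_neq_one)
qed (auto intro: that)

lemma lambda_min_le_eigenvalue: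
  fixes M :: "real^'n^'n"
  assumes "symmetric_mat M"
  shows "lambda_min M * (x \<bullet> x) \<le> x \<bullet> (M *v x)"
proof -
  obtain v c where cv: "v \<noteq> 0" "M *v v = c *s v" "\<forall>w. c * (w \<bullet> w) \<le> w \<bullet> (M *v w)"
    by (rule symmetric_min_eigenvector[OF assms])
  have "lambda_min M \<le> c"
    unfolding lambda_min_def
    by (rule Min_le) (use cv finite_spectrum_symmetric[OF assms] in \<open>auto simp: spectrum_def\<close>)
  then show ?thesis
    using cv(3)[rule_format, of x] mult_right_mono[of "lambda_min M" c "x \<bullet> x"] by simp
qed

lemma lambda_min_pos:
  fixes M :: "real^'n^'n"
  assumes "pd M"
  shows "0 < lambda_min M"
proof -
  have sym: "symmetric_mat M" using assms by (simp add: pd_def)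
  obtain v c where "v \<noteq> 0" "M *v v = c *s v"
    by (rule symmetric_min_eigenvector[OF sym])
  then have "spectrum M \<noteq> {}" by (auto simp: spectrum_def)
  then have "lambda_min M \<in> spectrum M"
    unfolding lambda_min_def using finite_spectrum_symmetric[OF sym] by simp
  then obtain v where v: "v \<noteq> 0" "M *v v = lambda_min M *s v" by (auto simp: spectrum_def)
  have "0 < v \<bullet> (M *v v)" using assms v(1) by (simp add: pd_def)
  then show ?thesis
    using v(1) unfolding v(2) scalar_mult_eq_scaleR inner_scaleR_right
    by (metis inner_gt_zero_iff zero_less_mult_pos2)
qed

text \<open>Needed because \<open>spectral_radius\<close> is defined through complex eigenvalues.
  With \<open>a\<close> and \<open>b\<close> the real and imaginary parts of an eigenvector,
  symmetry applied to the pair \<open>a\<close>, \<open>b\<close> forces \<open>Im z = 0\<close>,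
  and whichever part is nonzero is a real eigenvector.\<close>

lemma spectrum_complex_of_symmetric:
  fixes M :: "real^'n^'n"
  assumes sym: "symmetric_mat M"
  shows "spectrum (map_matrix complex_of_real M) = complex_of_real ` spectrum M"
proof (intro subset_antisym subsetI)
  fix z assume "z \<in> spectrum (map_matrix complex_of_real M)"
  then obtain v where v: "v \<noteq> 0" "map_matrix complex_of_real M *v v = z *s v"
    by (auto simp: spectrum_def)
  define a where "a = (\<chi> i. Re (v $ i))"
  define b where "b = (\<chi> i. Im (v $ i))"
  have "(map_matrix complex_of_real M *v v) $ i = z * v $ i" for i using v(2) by simp
  then have "(\<Sum>j\<in>UNIV. complex_of_real (M $ i $ j) * v $ j) = z * v $ i" for i
    by (simp add: matrix_vector_mult_def)
  note comps = arg_cong[OF this, of Re] arg_cong[OF this, of Im]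
  have Ma: "M *v a = Re z *\<^sub>R a - Im z *\<^sub>R b"
    using comps(1) by (simp add: vec_eq_iff matrix_vector_mult_def a_def b_def)
  have Mb: "M *v b = Re z *\<^sub>R b + Im z *\<^sub>R a"
    using comps(2) by (simp add: vec_eq_iff matrix_vector_mult_def a_def b_def)
  have ab: "a \<noteq> 0 \<or> b \<noteq> 0"
    using v(1) by (auto simp: vec_eq_iff a_def b_def complex_eq_iff)
  have "Im z * (a \<bullet> a + b \<bullet> b) = 0"
    using symmetric_mat_inner[OF sym, of a b]
    by (simp add: Ma Mb inner_diff_left inner_add_right algebra_simps)
  moreover have "a \<bullet> a + b \<bullet> b > 0"
    using ab by (metis add_nonneg_pos add_pos_nonneg inner_ge_zero inner_gt_zero_iff)
  ultimately have "Im z = 0" by simp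
  then have "Re z \<in> spectrum M"
    using Ma Mb ab by (auto simp: spectrum_def scalar_mult_eq_scaleR)
  then show "z \<in> complex_of_real ` spectrum M"
    using \<open>Im z = 0\<close> by (intro image_eqI[of _ _ "Re z"]) (auto simp: complex_eq_iff)
next
  fix z assume "z \<in> complex_of_real ` spectrum M"
  then obtain v c where c: "z = complex_of_real c" "v \<noteq> 0" "M *v v = c *s v"
    by (auto simp: spectrum_def)
  have "(M *v v) $ i = c * v $ i" for i using c(3) by simp
  then have comp: "(\<Sum>j\<in>UNIV. M $ i $ j * v $ j) = c * v $ i" for i
    by (simp add: matrix_vector_mult_def)
  have "map_matrix complex_of_real M *v (\<chi> i. complex_of_real (v $ i))
      = z *s (\<chi> i. complex_of_real (v $ i))"
    by (simp add: vec_eq_iff matrix_vector_mult_def c(1) comp flip: of_real_mult of_real_sum)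
  moreover have "(\<chi> i. complex_of_real (v $ i)) \<noteq> 0"
    using c(2) by (auto simp: vec_eq_iff)
  ultimately show "z \<in> spectrum (map_matrix complex_of_real M)"
    by (auto simp: spectrum_def)
qed

lemma spectral_radius_ge_abs_eigenvalue:
  fixes M :: "real^'n^'n"
  assumes "symmetric_mat M" "c \<in> spectrum M"
  shows "\<bar>c\<bar> \<le> spectral_radius M"
  unfolding spectral_radius_def spectrum_complex_of_symmetric[OF assms(1)]
  using finite_spectrum_symmetric[OF assms(1)] assms(2)
  by (intro Max_ge) (force simp: image_image)+

text \<open>The largest eigenvalue of \<open>M\<close> is minus the Rayleigh minimum of
  \<open>- M\<close>; it bounds the form from above and is itself bounded by the spectral
  radius.\<close>

lemma
  fixes M :: "real^'n^'n"
  assumes sym: "symmetric_mat M"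
  shows quadratic_form_le_spectral_radius: "x \<bullet> (M *v x) \<le> spectral_radius M * (x \<bullet> x)"
    and spectral_radius_nonneg: "0 \<le> spectral_radius M"
proof -
  have N: "(- M) *v x = - (M *v x)" for x
    by (metis diff_0 matrix_vector_mult_0 matrix_vector_mult_diff_rdistrib)
  have "symmetric_mat (- M)"
    using sym by (simp add: symmetric_mat_iff_inner N)
  then obtain v c where cv: "v \<noteq> 0" "- M *v v = c *s v"
      "\<forall>w. c * (w \<bullet> w) \<le> w \<bullet> (- M *v w)"
    by (rule symmetric_min_eigenvector)
  have "M *v v = (- c) *s v"
    using cv(2) by (metis N add.inverse_inverse scaleR_minus_left scalar_mult_eq_scaleR)
  then have "- c \<in> spectrum M" using cv(1) by (auto simp: spectrum_def)
  then have le: "\<bar>- c\<bar> \<le> spectral_radius M" by (rule spectral_radius_ge_abs_eigenvalue[OF sym])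
  then show "0 \<le> spectral_radius M" by simp
  have "- c \<le> spectral_radius M" using le by simp
  then have "- c * (x \<bullet> x) \<le> spectral_radius M * (x \<bullet> x)" by (intro mult_right_mono) auto
  then show "x \<bullet> (M *v x) \<le> spectral_radius M * (x \<bullet> x)" using cv(3)[rule_format, of x] by (simp add: N)
qed

text \<open>The null space is a line, so 0 occurs exactly once in the sorted list and position 1
  holds the least positive eigenvalue. The Rayleigh minimum \<open>c\<close> over the complement of
  \<open>u\<close> is a nonzero eigenvalue, hence at least \<open>lambda2 M\<close>. Dimension at
  least 2 makes that complement nontrivial.\<close>

lemma
  fixes M :: "real^'n^'n"
  assumes M: "psd M" and null: "{v. M *v v = 0} = span {u}" and u: "u \<noteq> 0"
    and n: "2 \<le> CARD('n)"
  shows lambda2_pos: "0 < lambda2 M"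
    and lambda2_le_quadratic_form: "\<And>x. u \<bullet> x = 0 \<Longrightarrow> lambda2 M * (x \<bullet> x) \<le> x \<bullet> (M *v x)"
proof -
  have sym: "symmetric_mat M" and nonneg: "\<And>x. 0 \<le> x \<bullet> (M *v x)"
    using M by (auto simp: psd_def)
  have fin: "finite (spectrum M)" by (rule finite_spectrum_symmetric[OF sym])
  define E where "E z = {v. M *v v = z *s v}" for z
  have Mu: "M *v u = 0" using null span_base[of u "{u}"] by blast
  define S where "S = {x. u \<bullet> x = 0}"
  have sub: "subspace S" unfolding S_def by (rule subspace_hyperplane)
  have inv: "M *v x \<in> S" if "x \<in> S" for x
    using symmetric_mat_inner[OF sym, of u x] Mu by (simp add: S_def)
  have ne: "S \<noteq> {0}"
  proof
    assume "S = {0}"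
    then have "dim S = 0" by simp
    then show False using dim_hyperplane[OF u] n by (simp add: S_def)
  qed
  obtain v c where cv: "v \<in> S" "v \<noteq> 0" "M *v v = c *s v"
      "\<forall>w\<in>S. c * (w \<bullet> w) \<le> w \<bullet> (M *v w)"
    by (rule rayleigh_min_eigenvector[OF sym sub inv ne])
  have c_spec: "c \<in> spectrum M" using cv by (auto simp: spectrum_def)
  have spec_nonneg: "0 \<le> z" if z: "z \<in> spectrum M" for z
  proof -
    obtain w where w: "w \<noteq> 0" "M *v w = z *s w" using z by (auto simp: spectrum_def)
    have "0 \<le> z * (w \<bullet> w)" using nonneg[of w] w(2) by (simp add: scalar_mult_eq_scaleR)
    then show ?thesis using w(1) by (metis inner_gt_zero_iff not_less zero_le_mult_iff)
  qed
  have zero_spec: "0 \<in> spectrum M" using Mu u by (auto simp: spectrum_def)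
  have c_ne: "c \<noteq> 0"
  proof
    assume "c = 0"
    then have "v \<in> span {u}" using cv(3) null by auto
    then obtain k where "v = k *\<^sub>R u" by (auto simp: span_singleton)
    then show False using cv(1,2) u by (simp add: S_def)
  qed
  \<comment> \<open>\<open>P\<close> is the multiset of nonzero eigenvalues; the full one adds a
    single 0, which sorting puts at the head.\<close>
  define P where "P = (\<Sum>z\<in>spectrum M - {0}. replicate_mset (dim (E z)) z)"
  have "dim (E 0) = 1"
    using null u by (simp add: E_def dim_eq_card_independent)
  then have ms: "(\<Sum>z\<in>spectrum M. replicate_mset (dim (E z)) z) = add_mset 0 P"
    using sum.remove[OF fin zero_spec, of "\<lambda>z. replicate_mset (dim (E z)) z"] by (simp add: P_def)
  have set_P: "set_mset P \<subseteq> spectrum M - {0}"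
    unfolding P_def using fin by (auto simp: set_mset_sum split: if_splits)
  have "dim (E c) \<noteq> 0" using cv(2,3) by (auto simp: E_def dim_eq_0)
  then have c_P: "c \<in># P"
    unfolding P_def using fin c_spec c_ne by (auto simp: set_mset_sum)
  define xs where "xs = sorted_list_of_multiset P"
  have set_xs: "set xs = set_mset P" by (simp add: xs_def)
  have "sorted_list_of_multiset (add_mset 0 P) = insort 0 xs" by (simp add: xs_def)
  also have "\<dots> = 0 # xs"
    using set_P spec_nonneg set_xs by (intro insort_is_Cons) auto
  finally have "sorted_eigenvalues M = 0 # xs"
    unfolding sorted_eigenvalues_def using ms unfolding E_def by simp
  moreover have "xs \<noteq> []" using c_P set_xs by auto
  ultimately have l2: "lambda2 M = hd xs" by (simp add: lambda2_def hd_conv_nth)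
  have "hd xs \<in> spectrum M - {0}" using hd_in_set[OF \<open>xs \<noteq> []\<close>] set_xs set_P by blast
  then show "0 < lambda2 M" using spec_nonneg l2 by (metis DiffD1 DiffD2 insertI1 order_le_less)
  have "sorted xs" by (simp add: xs_def)
  moreover have "c \<in> set xs" using c_P set_xs by simp
  ultimately have "hd xs \<le> c" by (cases xs) auto
  then have "lambda2 M \<le> c" using l2 by simp
  then show "lambda2 M * (x \<bullet> x) \<le> x \<bullet> (M *v x)" if "u \<bullet> x = 0" for x
    using cv(4)[rule_format, of x] that mult_right_mono[of "lambda2 M" c "x \<bullet> x"] by (simp add: S_def)
qed

section \<open>Frobenius inner product and smooth convex functions\<close>

text \<open>Left multiplication acts on each column separately, so inequalities for vectors carry
  over to matrices by summing over columns.\<close>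

lemma inner_matrix_columns:
  fixes X Y :: "real^'d^'m"
  shows "X \<bullet> Y = (\<Sum>j\<in>UNIV. column j X \<bullet> column j Y)"
  by (simp add: inner_vec_def column_def) (rule sum.swap)

lemma column_matrix_mult: "column j (M ** X) = M *v column j X"
  by (simp add: vec_eq_iff column_def matrix_matrix_mult_def matrix_vector_mult_def)

lemma matrix_mult_diff_right: "M ** (X - Y) = M ** X - M ** (Y :: real^'d^'m)"
  by (simp add: vec_eq_iff matrix_matrix_mult_def sum_subtractf algebra_simps)

lemma matrix_mult_scaleR_right: "M ** (c *\<^sub>R X) = c *\<^sub>R (M ** (X :: real^'d^'m))"
  by (simp add: vec_eq_iff matrix_matrix_mult_def sum_distrib_left algebra_simps)

lemma matrix_mult_zero_right: "M ** (0 :: real^'d^'m) = 0"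
  by (simp add: vec_eq_iff matrix_matrix_mult_def)

lemma matrix_mult_diff_left: "(M - N) ** X = M ** X - N ** (X :: real^'d^'m)"
  by (simp add: vec_eq_iff matrix_matrix_mult_def sum_subtractf algebra_simps)

lemma symmetric_mat_inner_matrix:
  fixes M :: "real^'m^'m" and X Y :: "real^'d^'m"
  assumes "symmetric_mat M"
  shows "(M ** X) \<bullet> Y = X \<bullet> (M ** Y)"
  by (simp add: inner_matrix_columns column_matrix_mult symmetric_mat_inner[OF assms])

lemma weighted_norm_eq: "weighted_norm D X = sqrt (X \<bullet> (D ** X))"
proof -
  have "trace (transpose X ** D ** X) = X \<bullet> (D ** X)"
    by (simp add: trace_def inner_matrix_columns column_matrix_mult flip: matrix_mul_assoc)
       (simp add: matrix_matrix_mult_def transpose_def inner_vec_def column_def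
          matrix_vector_mult_def)
  then show ?thesis by (simp add: weighted_norm_def)
qed

lemma matrix_mult_consensual: "M ** consensual x = (\<chi> i. (M *v 1) $ i *\<^sub>R x)"
  by (simp add: vec_eq_iff consensual_def matrix_matrix_mult_def matrix_vector_mult_def
      sum_distrib_right)

lemma inner_consensual: "X \<bullet> consensual x = (\<Sum>i\<in>UNIV. X $ i) \<bullet> x"
  by (simp add: inner_vec_def[of X] consensual_def inner_sum_left)

lemma averaging_mat_vec: "averaging_mat *v v = ((1 \<bullet> v) / real CARD('m)) *\<^sub>R (1 :: real^'m)"
  by (simp add: vec_eq_iff averaging_mat_def matrix_vector_mult_def inner_vec_def
      flip: sum_divide_distrib)

lemma averaging_mat_mult:
  "averaging_mat ** X = consensual ((1 / real CARD('m)) *\<^sub>R (\<Sum>i\<in>UNIV. X $ i))"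
  for X :: "real^'d^'m"
  by (simp add: vec_eq_iff averaging_mat_def consensual_def matrix_matrix_mult_def
      sum_distrib_left)

lemma symmetric_averaging_mat: "symmetric_mat averaging_mat"
  by (simp add: symmetric_mat_def averaging_mat_def transpose_def)

section \<open>Gradients, convexity and smoothness\<close>

lemma GDERIV_gradient:
  fixes f :: "'a::euclidean_space \<Rightarrow> real"
  assumes "f differentiable (at x)"
  shows "GDERIV f x :> gradient f x"
proof -
  obtain f' where f': "(f has_derivative f') (at x)"
    using assms by (auto simp: differentiable_def)
  then have lin: "linear f'" using has_derivative_linear by blast
  have "GDERIV f x :> (\<Sum>b\<in>Basis. f' b *\<^sub>R b)"
  proof -
    have "f' h = h \<bullet> (\<Sum>b\<in>Basis. f' b *\<^sub>R b)" for h
    proof -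
      have "f' h = f' (\<Sum>b\<in>Basis. (h \<bullet> b) *\<^sub>R b)" by (simp add: euclidean_representation)
      also have "\<dots> = h \<bullet> (\<Sum>b\<in>Basis. f' b *\<^sub>R b)"
        by (simp add: linear_sum[OF lin] linear_cmul[OF lin] inner_sum_right mult.commute)
      finally show ?thesis .
    qed
    then have "f' = (\<lambda>h. h \<bullet> (\<Sum>b\<in>Basis. f' b *\<^sub>R b))" by blast
    then show ?thesis using f' by (simp add: gderiv_def)
  qed
  \<comment> \<open>Together with the existence just shown, uniqueness makes the definite
    description in \<open>gradient\<close> denote.\<close>
  moreover have "D = E" if "GDERIV f x :> D" "GDERIV f x :> E" for D E
  proof -
    have "(\<lambda>h. h \<bullet> D) = (\<lambda>h. h \<bullet> E)"
      using that has_derivative_unique unfolding gderiv_def by blast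
    then show ?thesis by (metis vector_eq_ldot)
  qed
  ultimately show ?thesis unfolding gradient_def by (metis theI)
qed

lemma DERIV_along_line:
  fixes f :: "'a::euclidean_space \<Rightarrow> real"
  assumes "\<And>x. f differentiable (at x)"
  shows "((\<lambda>t. f (x + t *\<^sub>R d)) has_real_derivative gradient f (x + t *\<^sub>R d) \<bullet> d) (at t)"
proof -
  have "(f has_derivative (\<lambda>h. h \<bullet> gradient f (x + t *\<^sub>R d))) (at (x + t *\<^sub>R d))"
    using GDERIV_gradient[OF assms] by (simp add: gderiv_def)
  moreover have "((\<lambda>t. x + t *\<^sub>R d) has_derivative (\<lambda>s. s *\<^sub>R d)) (at t)"
    by (auto intro!: derivative_eq_intros)
  ultimately have "((\<lambda>t. f (x + t *\<^sub>R d)) has_derivative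
      (\<lambda>s. (s *\<^sub>R d) \<bullet> gradient f (x + t *\<^sub>R d))) (at t)"
    using has_derivative_compose[of "\<lambda>t. x + t *\<^sub>R d" _ t UNIV f] by blast
  then show ?thesis
    by (simp add: has_field_derivative_def inner_commute mult_commute_abs)
qed

lemma convex_above_gradient:
  fixes f :: "'a::euclidean_space \<Rightarrow> real"
  assumes conv: "convex_on UNIV f" and diff: "\<And>x. f differentiable (at x)"
  shows "f x + gradient f x \<bullet> (y - x) \<le> f y"
proof -
  let ?\<phi> = "\<lambda>t. f (x + t *\<^sub>R (y - x))"
  have "convex_on UNIV ?\<phi>"
  proof (rule convex_onI)
    fix t a b :: real assume t: "0 < t" "t < 1"
    have "x + ((1 - t) *\<^sub>R a + t *\<^sub>R b) *\<^sub>R (y - x)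
        = (1 - t) *\<^sub>R (x + a *\<^sub>R (y - x)) + t *\<^sub>R (x + b *\<^sub>R (y - x))"
      by (simp add: algebra_simps)
    then show "?\<phi> ((1 - t) *\<^sub>R a + t *\<^sub>R b) \<le> (1 - t) * ?\<phi> a + t * ?\<phi> b"
      using convex_onD[OF conv, of t "x + a *\<^sub>R (y - x)" "x + b *\<^sub>R (y - x)"] t by simp
  qed simp
  then have "?\<phi> 1 - ?\<phi> 0 \<ge> gradient f (x + 0 *\<^sub>R (y - x)) \<bullet> (y - x) * (1 - 0)"
    by (rule convex_on_imp_above_tangent)
       (use DERIV_along_line[OF diff, of x "y - x" 0] in auto)
  then show ?thesis by simp
qed

lemma smooth_descent:
  fixes f :: "'a::euclidean_space \<Rightarrow> real"
  assumes smooth: "smooth L f"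
  shows "f y \<le> f x + gradient f x \<bullet> (y - x) + L / 2 * (norm (y - x))\<^sup>2"
proof -
  have diff: "\<And>x. f differentiable (at x)" and lip: "L-lipschitz_on UNIV (gradient f)"
    using smooth by (auto simp: smooth_def)
  define d where "d = y - x"
  \<comment> \<open>\<open>\<phi>\<close> is the gap to the claimed quadratic upper bound along the
    segment, up to the constant \<open>f x\<close>. The Lipschitz gradient makes its derivative
    nonpositive on the unit interval.\<close>
  define \<phi> where "\<phi> t = f (x + t *\<^sub>R d) - t * (gradient f x \<bullet> d) - L / 2 * t\<^sup>2 * (norm d)\<^sup>2" for t
  have "\<phi> 1 \<le> \<phi> 0"
  proof (rule DERIV_nonpos_imp_nonincreasing[of 0 1 \<phi>])
    fix t :: real assume t: "0 \<le> t" "t \<le> 1"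
    have "(\<phi> has_real_derivative
        gradient f (x + t *\<^sub>R d) \<bullet> d - gradient f x \<bullet> d - L * t * (norm d)\<^sup>2) (at t)"
      unfolding \<phi>_def
      by (auto intro!: derivative_eq_intros DERIV_along_line[OF diff])
    moreover have "gradient f (x + t *\<^sub>R d) \<bullet> d - gradient f x \<bullet> d \<le> L * t * (norm d)\<^sup>2"
    proof -
      have "gradient f (x + t *\<^sub>R d) \<bullet> d - gradient f x \<bullet> d
          \<le> norm (gradient f (x + t *\<^sub>R d) - gradient f x) * norm d"
        by (metis inner_diff_left norm_cauchy_schwarz)
      also have "\<dots> \<le> (L * norm (t *\<^sub>R d)) * norm d"
        using lipschitz_onD[OF lip, of "x + t *\<^sub>R d" x]
        by (intro mult_right_mono) (auto simp: dist_norm)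
      finally show ?thesis using t by (simp add: power2_eq_square algebra_simps)
    qed
    ultimately show "\<exists>y. (\<phi> has_real_derivative y) (at t) \<and> y \<le> 0" by force
  qed simp
  then show ?thesis by (simp add: \<phi>_def d_def algebra_simps)
qed

lemma stacked_fun_above_gradient:
  fixes f :: "'m::finite \<Rightarrow> real^'d \<Rightarrow> real"
  assumes "\<And>i. convex_on UNIV (f i)" "\<And>i x. f i differentiable (at x)"
  shows "stacked_fun f X + stacked_grad f X \<bullet> (Y - X) \<le> stacked_fun f Y"
  unfolding stacked_fun_def stacked_grad_def inner_vec_def[of "\<chi> i. gradient (f i) (X $ i)"]
  by (simp add: convex_above_gradient assms sum_mono flip: sum.distrib)

lemma norm_squared_rows: "(norm X)\<^sup>2 = (\<Sum>i\<in>UNIV. (norm (X $ i))\<^sup>2)"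
  for X :: "'a::real_inner^'m"
  by (simp add: power2_norm_eq_inner inner_vec_def)

lemma stacked_fun_descent:
  fixes f :: "'m::finite \<Rightarrow> real^'d \<Rightarrow> real"
  assumes "\<And>i. smooth L (f i)"
  shows "stacked_fun f Y
    \<le> stacked_fun f X + stacked_grad f X \<bullet> (Y - X) + L / 2 * (norm (Y - X))\<^sup>2"
  unfolding stacked_fun_def stacked_grad_def inner_vec_def[of "\<chi> i. gradient (f i) (X $ i)"]
    norm_squared_rows[of "Y - X"] sum_distrib_left sum.distrib[symmetric]
  using smooth_descent[OF assms] by (intro sum_mono) simp

lemma convex_on_stacked_fun:
  fixes f :: "'m::finite \<Rightarrow> real^'d \<Rightarrow> real"
  assumes "\<And>i. convex_on UNIV (f i)"
  shows "convex_on UNIV (stacked_fun f)"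
proof (rule convex_onI)
  fix t :: real and X Y :: "real^'d^'m" assume "0 < t" "t < 1"
  then have "f i (((1 - t) *\<^sub>R X + t *\<^sub>R Y) $ i) \<le> (1 - t) * f i (X $ i) + t * f i (Y $ i)" for i
    using convex_onD[OF assms] by simp
  then show "stacked_fun f ((1 - t) *\<^sub>R X + t *\<^sub>R Y)
      \<le> (1 - t) * stacked_fun f X + t * stacked_fun f Y"
    unfolding stacked_fun_def by (simp add: sum_mono sum_distrib_left flip: sum.distrib)
qed simp

lemma sum_gradients_at_minimizer:
  fixes f :: "'i::finite \<Rightarrow> 'a::euclidean_space \<Rightarrow> real"
  assumes diff: "\<And>i. f i differentiable (at x)"
    and min: "\<And>y. (\<Sum>i\<in>UNIV. f i x) \<le> (\<Sum>i\<in>UNIV. f i y)"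
  shows "(\<Sum>i\<in>UNIV. gradient (f i) x) = 0"
proof -
  have "((\<lambda>y. \<Sum>i\<in>UNIV. f i y) has_derivative (\<lambda>h. \<Sum>i\<in>UNIV. h \<bullet> gradient (f i) x)) (at x)"
    using GDERIV_gradient[OF diff] unfolding gderiv_def by (intro has_derivative_sum)
  then have "(\<lambda>h. \<Sum>i\<in>UNIV. h \<bullet> gradient (f i) x) = (\<lambda>h. 0)"
    by (rule has_derivative_local_min) (simp add: min)
  then have "h \<bullet> (\<Sum>i\<in>UNIV. gradient (f i) x) = 0" for h
    by (simp add: inner_sum_right fun_eq_iff)
  then show ?thesis by (metis inner_eq_zero_iff)
qed

section \<open>The primal-dual iteration\<close>

locale abc_matrices =
  fixes B C D :: "real^'m^'m"
  assumes card: "2 \<le> CARD('m)"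
    and B: "psd B" and C: "psd C" and D: "pd D"
    and B_one: "B *v 1 = 1" and D_one: "D *v 1 = 1"
    and C_null: "{v. C *v v = 0} = span {1}"
    and commute: "B ** C = C ** B"
    and contraction: "psd (mat 1 - (1/2) *\<^sub>R C - psd_sqrt B ** D ** psd_sqrt B)"
begin

lemma sym_B: "symmetric_mat B" and sym_C: "symmetric_mat C" and sym_D: "symmetric_mat D"
  using B C D by (auto simp: psd_def pd_def)

lemma C_one: "C *v 1 = 0"
  using C_null span_base[of 1 "{1}"] by blast

definition S :: "real^'m^'m" where "S = psd_sqrt B"

lemma S: "psd S" "S ** S = B" "S ** C = C ** S" "S *v 1 = 1"
  unfolding S_def
  using psd_sqrt_works[OF B] psd_sqrt_commute[OF B commute] psd_sqrt_fixes[OF B B_one] by auto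

lemma sym_S: "symmetric_mat S"
  using S(1) by (simp add: psd_def)

definition \<rho> :: real where "\<rho> = spectral_radius (B - averaging_mat)"

definition \<mu> :: real where "\<mu> = lambda2 C"

lemma \<mu>_pos: "0 < \<mu>"
  unfolding \<mu>_def using lambda2_pos[OF C C_null] card by simp

lemma sym_B_J: "symmetric_mat (B - averaging_mat)"
  using symmetric_averaging_mat sym_B
  by (simp add: symmetric_mat_iff_inner matrix_vector_mult_diff_rdistrib inner_diff_left
      inner_diff_right)

lemma \<rho>_nonneg: "0 \<le> \<rho>"
  unfolding \<rho>_def by (rule spectral_radius_nonneg[OF sym_B_J])

lemma S_twice: "S *v (S *v w) = B *v w"
  by (simp add: matrix_vector_mul_assoc S(2))

text \<open>The root of \<open>B\<close> commutes with \<open>C\<close>, so one factor moves across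
  the inner product and joins the other to form \<open>B\<close>.\<close>

lemma root_form: "(S *v w) \<bullet> (C *v (S *v w)) = w \<bullet> (C *v (B *v w))"
proof -
  have "S *v (C *v (S *v w)) = C *v (B *v w)"
    using S(3) by (metis S_twice matrix_vector_mul_assoc)
  then show ?thesis by (simp add: symmetric_mat_inner[OF sym_S])
qed

text \<open>Let \<open>v\<close> be the part of \<open>S *v w\<close> orthogonal to the ones vector.
  Then \<open>S *v v\<close> is the disagreement of \<open>B *v w\<close>, its squared norm is the
  form of \<open>B - averaging_mat\<close> at \<open>v\<close> and so costs a factor
  \<open>\<rho>\<close>, and orthogonality to the ones vector lets \<open>C\<close> dominate
  \<open>\<mu>\<close> times the squared norm of \<open>v\<close>. As \<open>C\<close> annihilates
  the ones vector, \<open>v\<close> may be replaced by \<open>S *v w\<close> in the form of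
  \<open>C\<close>.\<close>

lemma disagreement_le:
  "(norm ((mat 1 - averaging_mat) *v (B *v w)))\<^sup>2 \<le> \<rho> / \<mu> * (w \<bullet> (C *v (B *v w)))"
proof -
  define v where "v = S *v w - averaging_mat *v (S *v w)"
  have one_S: "1 \<bullet> (S *v x) = 1 \<bullet> x" for x
    using symmetric_mat_inner[OF sym_S, of 1 x] S(4) by simp
  have card_eq: "(1 :: real^'m) \<bullet> 1 = real CARD('m)" by (simp add: inner_vec_def)
  have orth: "1 \<bullet> v = 0"
    by (simp add: v_def averaging_mat_vec inner_diff_right card_eq)
  have "S *v v = (mat 1 - averaging_mat) *v (B *v w)"
    by (simp add: v_def matrix_vector_mult_diff_distrib matrix_vector_mult_diff_rdistrib
        averaging_mat_vec matrix_vector_mult_scaleR S(4) S_twice)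
       (simp add: one_S flip: S_twice)
  then have "(norm ((mat 1 - averaging_mat) *v (B *v w)))\<^sup>2 = (S *v v) \<bullet> (S *v v)"
    by (simp add: power2_norm_eq_inner)
  also have "\<dots> = v \<bullet> ((B - averaging_mat) *v v)"
    by (simp add: symmetric_mat_inner[OF sym_S] S_twice matrix_vector_mult_diff_rdistrib
        averaging_mat_vec orth)
  also have "\<dots> \<le> \<rho> * (v \<bullet> v)"
    unfolding \<rho>_def by (rule quadratic_form_le_spectral_radius[OF sym_B_J])
  also have "\<dots> = \<rho> / \<mu> * (\<mu> * (v \<bullet> v))"
    using \<mu>_pos by simp
  also have "\<dots> \<le> \<rho> / \<mu> * (v \<bullet> (C *v v))"
    using lambda2_le_quadratic_form[OF C C_null _ card orth] \<rho>_nonneg \<mu>_pos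
    by (intro mult_left_mono) (auto simp: \<mu>_def)
  also have "v \<bullet> (C *v v) = (S *v w) \<bullet> (C *v (S *v w))"
  proof -
    have "C *v v = C *v (S *v w)"
      by (simp add: v_def matrix_vector_mult_diff_distrib averaging_mat_vec
          matrix_vector_mult_scaleR C_one)
    then show ?thesis
      using symmetric_mat_inner[OF sym_C, of v v] symmetric_mat_inner[OF sym_C, of v "S *v w"]
        symmetric_mat_inner[OF sym_C, of "S *v w" "S *v w"]
      by (simp add: inner_commute)
  qed
  also have "\<dots> = w \<bullet> (C *v (B *v w))" by (rule root_form)
  finally show ?thesis .
qed

lemma disagreement_lift:
  fixes W :: "real^'d^'m"
  shows "(norm ((mat 1 - averaging_mat) ** (B ** W)))\<^sup>2 \<le> \<rho> / \<mu> * (W \<bullet> (C ** (B ** W)))"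
  unfolding power2_norm_eq_inner inner_matrix_columns column_matrix_mult sum_distrib_left
  using disagreement_le by (intro sum_mono) (simp add: power2_norm_eq_inner)

text \<open>Condition (v) tested on \<open>\<surd>B Z\<close>.\<close>

lemma contraction_lift:
  fixes Z :: "real^'d^'m"
  shows "(B ** Z) \<bullet> (D ** (B ** Z)) + 1 / 2 * (Z \<bullet> (C ** (B ** Z))) \<le> Z \<bullet> (B ** Z)"
proof -
  have "(B *v z) \<bullet> (D *v (B *v z)) + 1 / 2 * (z \<bullet> (C *v (B *v z))) \<le> z \<bullet> (B *v z)" for z
  proof -
    have "0 \<le> (S *v z) \<bullet> ((mat 1 - (1/2) *\<^sub>R C - S ** D ** S) *v (S *v z))"
      using contraction by (simp add: psd_def S_def)
    also have "\<dots> = (S *v z) \<bullet> (S *v z) - 1 / 2 * ((S *v z) \<bullet> (C *v (S *v z)))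
        - (S *v z) \<bullet> (S *v (D *v (S *v (S *v z))))"
      by (simp add: matrix_vector_mult_diff_rdistrib inner_diff_right
          flip: matrix_vector_mul_assoc scaleR_matrix_vector_assoc)
    also have "(S *v z) \<bullet> (S *v z) = z \<bullet> (B *v z)"
      by (simp add: symmetric_mat_inner[OF sym_S] S_twice)
    also have "(S *v z) \<bullet> (C *v (S *v z)) = z \<bullet> (C *v (B *v z))"
      by (rule root_form)
    also have "(S *v z) \<bullet> (S *v (D *v (S *v (S *v z)))) = (B *v z) \<bullet> (D *v (B *v z))"
      by (metis S_twice symmetric_mat_inner[OF sym_S])
    finally show ?thesis by simp
  qed
  then show ?thesis
    unfolding inner_matrix_columns column_matrix_mult sum_distrib_left
    by (simp add: sum_mono flip: sum.distrib)
qed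

lemma dual_form_nonneg:
  fixes W :: "real^'d^'m"
  shows "0 \<le> W \<bullet> (C ** (B ** W))"
proof -
  have "0 \<le> (S *v w) \<bullet> (C *v (S *v w))" for w using C by (simp add: psd_def)
  then show ?thesis
    unfolding inner_matrix_columns column_matrix_mult
    by (intro sum_nonneg) (simp add: root_form)
qed

text \<open>The potential is \<open>q\<close> of the distance to the solution plus the dual form
  \<open>h\<close> of the accumulated \<open>W\<close>. Its decrease pays for the objective gap, the
  only loss being a term that \<open>contraction_lift\<close> makes nonpositive.\<close>

lemma descent_step:
  fixes f :: "'m \<Rightarrow> real^'d \<Rightarrow> real" and X Z W :: "real^'d^'m" and x :: "real^'d"
  assumes convex: "\<And>i. convex_on UNIV (f i)" and smooth: "\<And>i. smooth L (f i)"
    and \<gamma>: "0 < \<gamma>" "\<gamma> * L \<le> lambda_min D"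
    and Z: "Z = D ** X - \<gamma> *\<^sub>R stacked_grad f X - C ** W"
    and Xs: "Xs = consensual x"
  defines "q \<equiv> \<lambda>V :: real^'d^'m. V \<bullet> (D ** V)"
    and "h \<equiv> \<lambda>V :: real^'d^'m. V \<bullet> (C ** (B ** V))"
  shows "2 * \<gamma> * (stacked_fun f (B ** Z) - stacked_fun f Xs)
    \<le> q (X - Xs) - q (B ** Z - Xs) + h W - h (W + Z)"
proof -
  have fix_D: "D ** Xs = Xs" and fix_B: "B ** Xs = Xs" and null_C: "C ** Xs = 0"
    by (simp_all add: Xs matrix_mult_consensual D_one B_one C_one)
       (simp_all add: consensual_def vec_eq_iff)
  define X' where "X' = B ** Z"
  define g where "g = stacked_grad f X"
  have diff: "f i differentiable (at y)" for i y using smooth by (simp add: smooth_def)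
  \<comment> \<open>Smoothness from \<open>X\<close> to \<open>X'\<close> and convexity from
    \<open>X\<close> to \<open>Xs\<close> use the same gradient \<open>g\<close>, so their linear
    terms combine.\<close>
  have "stacked_fun f X' - stacked_fun f Xs \<le> g \<bullet> (X' - Xs) + L / 2 * (norm (X' - X))\<^sup>2"
    using stacked_fun_descent[of L f X' X, OF smooth] stacked_fun_above_gradient[of f X Xs, OF convex diff]
    by (simp add: g_def inner_diff_right)
  then have "2 * \<gamma> * (stacked_fun f X' - stacked_fun f Xs)
      \<le> 2 * \<gamma> * (g \<bullet> (X' - Xs) + L / 2 * (norm (X' - X))\<^sup>2)"
    using \<gamma>(1) by (intro mult_left_mono) auto
  also have "\<dots> = 2 * ((\<gamma> *\<^sub>R g) \<bullet> (X' - Xs)) + \<gamma> * L * (norm (X' - X))\<^sup>2"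
    by (simp add: algebra_simps)
  also have "\<gamma> * L * (norm (X' - X))\<^sup>2 \<le> q (X' - X)"
  proof -
    have "\<gamma> * L * (norm (X' - X))\<^sup>2 \<le> lambda_min D * (norm (X' - X))\<^sup>2"
      using \<gamma>(2) by (rule mult_right_mono) simp
    also have "\<dots> \<le> q (X' - X)"
      unfolding q_def power2_norm_eq_inner inner_matrix_columns column_matrix_mult sum_distrib_left
      by (intro sum_mono lambda_min_le_eigenvalue[OF sym_D])
    finally show ?thesis .
  qed
  \<comment> \<open>An exact identity: the gradient is eliminated through the definition of
    \<open>Z\<close>, and symmetry of \<open>D\<close> produces the differences of \<open>q\<close>.
    Since \<open>B\<close> and \<open>C\<close> commute, \<open>h\<close> is the form of a symmetric
    matrix and its two cross terms agree.\<close>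
  also have "2 * ((\<gamma> *\<^sub>R g) \<bullet> (X' - Xs)) + q (X' - X)
      = q (X - Xs) - q (X' - Xs) + h W - h (W + Z)
        + 2 * (X' \<bullet> (D ** X') + 1 / 2 * h Z - Z \<bullet> (B ** Z))"
  proof -
    have g: "\<gamma> *\<^sub>R g = D ** X - C ** W - Z" using Z by (simp add: g_def)
    note symD = symmetric_mat_inner_matrix[OF sym_D]
    have d1: "(D ** X) \<bullet> X' = X' \<bullet> (D ** X)" "X \<bullet> (D ** X') = X' \<bullet> (D ** X)"
      by (metis inner_commute symD)+
    have d2: "(D ** V) \<bullet> Xs = V \<bullet> Xs" "Xs \<bullet> (D ** V) = V \<bullet> Xs" for V
      by (metis fix_D inner_commute symD)+
    have c: "(C ** W) \<bullet> Xs = 0"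
      using null_C symmetric_mat_inner_matrix[OF sym_C, of W Xs] by simp
    have z: "Z \<bullet> Xs = X' \<bullet> Xs"
      using fix_B symmetric_mat_inner_matrix[OF sym_B, of Z Xs] by (simp add: X'_def)
    have h1: "W \<bullet> (C ** (B ** Z)) = (C ** W) \<bullet> X'"
      by (simp add: X'_def symmetric_mat_inner_matrix[OF sym_C])
    have "C ** (B ** W) = B ** (C ** W)" by (simp add: matrix_mul_assoc commute)
    then have h2: "Z \<bullet> (C ** (B ** W)) = (C ** W) \<bullet> X'"
      using symmetric_mat_inner_matrix[OF sym_B, of Z "C ** W"] by (simp add: X'_def inner_commute)
    have hh: "h (W + Z) = h W + h Z + 2 * ((C ** W) \<bullet> X')"
      using h1 h2 by (simp add: h_def matrix_add_ldistrib inner_add_left inner_add_right)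
    show ?thesis
      unfolding g hh q_def
      by (simp add: matrix_mult_diff_right inner_diff_left inner_diff_right fix_D d1 d2 c z)
         (simp add: X'_def inner_commute algebra_simps)
  qed
  also have "\<dots> \<le> q (X - Xs) - q (X' - Xs) + h W - h (W + Z)"
    using contraction_lift[of Z] by (simp add: X'_def h_def)
  finally show ?thesis by (simp add: X'_def)
qed

text \<open>The factorization of the mixing matrix and the commutation of \<open>B\<close> with
  \<open>C\<close> let \<open>B\<close> be pulled out of every update. The sum starts at 1 because
  \<open>X 0\<close> is arbitrary and need not lie in the range of \<open>B\<close>.\<close>

lemma iterates_sum:
  fixes f :: "'m \<Rightarrow> real^'d \<Rightarrow> real" and X Y :: "nat \<Rightarrow> real^'d^'m"
  assumes iter: "ABC_iterates (B ** D) B C f \<gamma> X0 X Y"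
  obtains W :: "nat \<Rightarrow> real^'d^'m"
    where "W 0 = 0"
      "\<And>k. W (Suc k) = W k + (D ** X k - \<gamma> *\<^sub>R stacked_grad f (X k) - C ** W k)"
      "\<And>k. X (Suc k) = B ** (D ** X k - \<gamma> *\<^sub>R stacked_grad f (X k) - C ** W k)"
      "\<And>k. (\<Sum>t=1..k. X t) = B ** W k"
proof -
  define Z where "Z k V = D ** X k - \<gamma> *\<^sub>R stacked_grad f (X k) - C ** V" for k V
  define W where "W = rec_nat 0 (\<lambda>k V. V + Z k V)"
  have W: "W 0 = 0" "W (Suc k) = W k + Z k (W k)" for k by (simp_all add: W_def)
  \<comment> \<open>Stated conditionally on the form of \<open>Y k\<close>, so that it can serve
    inside the induction that establishes that form.\<close>
  have X_step: "X (Suc k) = B ** Z k (W k)" if "Y k = C ** (B ** W k)" for k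
  proof -
    have "X (Suc k) = (B ** D) ** X k - \<gamma> *\<^sub>R (B ** stacked_grad f (X k)) - Y k"
      using iter by (simp add: ABC_iterates_def)
    moreover have "C ** (B ** W k) = B ** (C ** W k)" by (simp add: matrix_mul_assoc commute)
    ultimately show ?thesis
      using that
      by (simp add: Z_def matrix_mult_diff_right matrix_mult_scaleR_right matrix_mul_assoc)
  qed
  have Y: "Y k = C ** (B ** W k)" for k
  proof (induction k)
    case 0
    then show ?case using iter by (simp add: ABC_iterates_def W matrix_mult_zero_right)
  next
    case (Suc k)
    have "Y (Suc k) = Y k + C ** X (Suc k)" using iter by (simp add: ABC_iterates_def)
    then show ?case using Suc X_step[OF Suc] by (simp add: W matrix_add_ldistrib)
  qed
  have "(\<Sum>t=1..k. X t) = B ** W k" for k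
    by (induction k) (simp_all add: W matrix_mult_zero_right matrix_add_ldistrib X_step[OF Y])
  then show thesis using that[of W] W X_step[OF Y] unfolding Z_def by blast
qed

lemma merit_le_rate_bound:
  fixes f :: "'m \<Rightarrow> real^'d \<Rightarrow> real" and X Y :: "nat \<Rightarrow> real^'d^'m" and x :: "real^'d"
  assumes convex: "\<And>i. convex_on UNIV (f i)" and smooth: "\<And>i. smooth L (f i)"
    and optimal: "\<And>y. (\<Sum>i\<in>UNIV. f i x) \<le> (\<Sum>i\<in>UNIV. f i y)"
    and \<gamma>: "0 < \<gamma>" "\<gamma> * L \<le> lambda_min D"
    and Xs: "Xs = consensual x"
    and iter: "ABC_iterates (B ** D) B C f \<gamma> X0 X Y"
    and k: "1 \<le> k"
  shows "merit f Xs (running_average X k)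
    \<le> rate_bound (weighted_norm D (X0 - Xs)) (norm (stacked_grad f Xs)) \<rho> \<mu> k \<gamma>"
proof -
  define q where "q V = V \<bullet> (D ** V)" for V :: "real^'d^'m"
  define h where "h V = V \<bullet> (C ** (B ** V))" for V :: "real^'d^'m"
  obtain W :: "nat \<Rightarrow> real^'d^'m" where W: "W 0 = 0"
      "\<And>k. W (Suc k) = W k + (D ** X k - \<gamma> *\<^sub>R stacked_grad f (X k) - C ** W k)"
      "\<And>k. X (Suc k) = B ** (D ** X k - \<gamma> *\<^sub>R stacked_grad f (X k) - C ** W k)"
      "\<And>k. (\<Sum>t=1..k. X t) = B ** W k"
    using iterates_sum[OF iter] by blast
  have X0: "X 0 = X0" using iter by (simp add: ABC_iterates_def)
  have diff: "f i differentiable (at y)" for i y using smooth by (simp add: smooth_def)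
  define F where "F V = stacked_fun f V - stacked_fun f Xs" for V
  have q_nonneg: "0 \<le> q V" for V
    unfolding q_def inner_matrix_columns column_matrix_mult
    using D by (intro sum_nonneg) (metis pd_def inner_zero_left order.refl order_less_imp_le)
  have step: "2 * \<gamma> * F (X (Suc t)) \<le> q (X t - Xs) - q (X (Suc t) - Xs) + h (W t) - h (W (Suc t))" for t
    using descent_step[where f = f and X = "X t" and W = "W t", OF convex smooth \<gamma> refl Xs]
    unfolding q_def h_def F_def W(2,3)[symmetric] .
  have tele: "2 * \<gamma> * (\<Sum>t=1..n. F (X t)) \<le> q (X0 - Xs) - q (X n - Xs) - h (W n)" for n
  proof (induction n)
    case 0
    then show ?case by (simp add: W(1) h_def X0)
  next
    case (Suc n)
    then show ?case using step[of n] by (simp add: distrib_left)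
  qed
  define Xh where "Xh = running_average X k"
  have kXh: "real k *\<^sub>R Xh = B ** W k"
    using k by (simp add: Xh_def running_average_def W(4)[symmetric])
  have jensen: "real k * F Xh \<le> (\<Sum>t=1..k. F (X t))"
  proof -
    have "Xh = (\<Sum>t=1..k. (1 / real k) *\<^sub>R X t)"
      by (simp add: Xh_def running_average_def scaleR_sum_right)
    then have "stacked_fun f Xh \<le> (\<Sum>t=1..k. 1 / real k * stacked_fun f (X t))"
      using convex_on_sum[of "{1..k}" UNIV "stacked_fun f" "\<lambda>_. 1 / real k" X]
        convex_on_stacked_fun[of f, OF convex] k
      by simp
    then have "real k * stacked_fun f Xh \<le> (\<Sum>t=1..k. stacked_fun f (X t))"
      using k by (simp add: field_simps flip: sum_divide_distrib)
    then show ?thesis by (simp add: F_def sum_subtractf right_diff_distrib)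
  qed
  define G where "G = norm (stacked_grad f Xs)"
  define s where "s = norm ((mat 1 - averaging_mat) ** (B ** W k))"
  define R where "R = weighted_norm D (X0 - Xs)"
  have R2: "R\<^sup>2 = q (X0 - Xs)"
    using q_nonneg by (simp add: R_def weighted_norm_eq q_def)
  have upper: "2 * \<gamma> * (real k * F Xh) \<le> R\<^sup>2 - h (W k)"
  proof -
    have "2 * \<gamma> * (real k * F Xh) \<le> 2 * \<gamma> * (\<Sum>t=1..k. F (X t))"
      using jensen \<gamma>(1) by (intro mult_left_mono) auto
    also have "\<dots> \<le> q (X0 - Xs) - q (X k - Xs) - h (W k)" by (rule tele)
    finally show ?thesis using q_nonneg[of "X k - Xs"] R2 by simp
  qed
  have h_nonneg: "0 \<le> h (W k)"
    unfolding h_def by (rule dual_form_nonneg)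
  have s2: "s\<^sup>2 \<le> \<rho> / \<mu> * h (W k)"
    unfolding s_def h_def by (rule disagreement_lift)
  \<comment> \<open>The average is kept multiplied by \<open>k\<close>, since
    \<open>real k *\<^sub>R Xh\<close> is \<open>B ** W k\<close>, to which the bound
    \<open>s2\<close> applies.\<close>
  have dis: "real k * norm ((mat 1 - averaging_mat) ** Xh) = s"
    by (simp add: s_def matrix_mult_scaleR_right flip: kXh)
  \<comment> \<open>The local gradients at the minimizer sum to zero, so the stacked gradient is
    orthogonal to every consensual matrix and only sees the disagreement of
    \<open>Xh\<close>.\<close>
  have lower: "- (G * s) \<le> real k * F Xh"
  proof -
    have "(\<Sum>i\<in>UNIV. stacked_grad f Xs $ i) = 0"
      using sum_gradients_at_minimizer[of f x, OF diff optimal]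
      by (simp add: stacked_grad_def Xs consensual_def)
    then have orth: "stacked_grad f Xs \<bullet> consensual y = 0" for y
      by (simp add: inner_consensual)
    have "stacked_grad f Xs \<bullet> (Xh - Xs) = stacked_grad f Xs \<bullet> ((mat 1 - averaging_mat) ** Xh)"
      by (simp add: Xs matrix_mult_diff_left averaging_mat_mult inner_diff_right orth[unfolded Xs])
    moreover have "stacked_grad f Xs \<bullet> (Xh - Xs) \<le> F Xh"
      using stacked_fun_above_gradient[of f Xs Xh, OF convex diff] by (simp add: F_def)
    moreover have "- (G * norm ((mat 1 - averaging_mat) ** Xh))
        \<le> stacked_grad f Xs \<bullet> ((mat 1 - averaging_mat) ** Xh)"
      unfolding G_def using Cauchy_Schwarz_ineq2 by (metis abs_le_D2 minus_le_iff)
    ultimately have "- (G * norm ((mat 1 - averaging_mat) ** Xh)) \<le> F Xh" by simp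
    then have "real k * - (G * norm ((mat 1 - averaging_mat) ** Xh)) \<le> real k * F Xh"
      by (rule mult_left_mono) simp
    then show ?thesis by (simp add: dis[symmetric] algebra_simps)
  qed
  define r where "r = \<rho> / \<mu>"
  have r: "0 \<le> r" using \<rho>_nonneg \<mu>_pos by (simp add: r_def)
  define T where "T = 1 / (2 * \<gamma>) * R\<^sup>2 + 2 * \<gamma> * r * G\<^sup>2"
  \<comment> \<open>AM-GM by completing the square of \<open>s - 2 * \<gamma> * r * G\<close>,
    divided by \<open>r\<close>; for \<open>r = 0\<close> the disagreement itself vanishes. The
    coefficient 4 is twice that of \<open>G * s\<close> in the lower bound, so adding
    \<open>upper\<close> and \<open>lower\<close> leaves one copy to estimate.\<close>
  have "0 \<le> h (W k) + 2 * \<gamma> * 2 * \<gamma> * r * G\<^sup>2 - 4 * \<gamma> * (G * s)"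
  proof (cases "r = 0")
    case True
    then have "s = 0" using s2 by (simp add: r_def[symmetric])
    then show ?thesis using True \<open>s = 0\<close> h_nonneg by simp
  next
    case False
    then have "0 < r" using r by simp
    then have "s\<^sup>2 / r \<le> h (W k)" using s2 by (simp add: r_def[symmetric] field_simps)
    moreover have "0 \<le> (s - 2 * \<gamma> * r * G)\<^sup>2 / r" using r by simp
    moreover have "(s - 2 * \<gamma> * r * G)\<^sup>2 / r = s\<^sup>2 / r + 2 * \<gamma> * 2 * \<gamma> * r * G\<^sup>2 - 4 * \<gamma> * (G * s)"
      using \<open>0 < r\<close> by (simp add: field_simps power2_eq_square)
    ultimately show ?thesis by simp
  qed
  moreover have "- (2 * \<gamma> * (G * s)) \<le> 2 * \<gamma> * (real k * F Xh)"
    using mult_left_mono[OF lower, of "2 * \<gamma>"] \<gamma>(1) by simp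
  ultimately have "2 * \<gamma> * (G * s) \<le> R\<^sup>2 + 2 * \<gamma> * 2 * \<gamma> * r * G\<^sup>2"
    using upper by linarith
  also have T: "R\<^sup>2 + 2 * \<gamma> * 2 * \<gamma> * r * G\<^sup>2 = 2 * \<gamma> * T"
    using \<gamma>(1) by (simp add: T_def field_simps)
  finally have GsT: "G * s \<le> T" using \<gamma>(1) by simp
  \<comment> \<open>The upper half of the bound on the absolute value; the lower half follows from
    \<open>lower\<close> and \<open>GsT\<close>.\<close>
  have "2 * \<gamma> * (real k * F Xh) \<le> R\<^sup>2 + 2 * \<gamma> * 2 * \<gamma> * r * G\<^sup>2"
    using upper h_nonneg r \<gamma>(1)
    by (smt (verit) mult_nonneg_nonneg zero_le_power2)
  then have "real k * F Xh \<le> T" using \<gamma>(1) unfolding T by simp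
  then have "real k * \<bar>F Xh\<bar> \<le> T" using GsT lower by (auto simp: abs_if)
  then have "\<bar>F Xh\<bar> \<le> 1 / real k * T" using k by (simp add: field_simps)
  moreover have "norm ((mat 1 - averaging_mat) ** Xh) * G \<le> 1 / real k * T"
    using GsT k by (simp add: dis[symmetric] field_simps)
  moreover have "1 / real k * T = rate_bound R G \<rho> \<mu> k \<gamma>"
    by (simp add: rate_bound_def T_def r_def)
  ultimately show ?thesis
    by (simp add: merit_def Xh_def F_def G_def R_def)
qed

end

section \<open>Step size\<close>

text \<open>Factoring the difference reduces every comparison of step sizes to the signs of two
  factors, with no calculus. For \<open>k = 0\<close> both sides are 0 by division by zero.\<close>

lemma rate_bound_diff:
  assumes "0 < a" "0 < b"
  shows "rate_bound R G \<rho> \<mu> k a - rate_bound R G \<rho> \<mu> k b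
    = (b - a) / (real k * 2 * a * b) * (R\<^sup>2 - 4 * (\<rho> / \<mu> * G\<^sup>2) * (a * b))"
proof (cases "k = 0")
  case False
  define c where "c = \<rho> / \<mu> * G\<^sup>2"
  have eq: "rate_bound R G \<rho> \<mu> k t = 1 / real k * (1 / (2 * t) * R\<^sup>2 + 2 * t * c)" for t
    by (simp add: rate_bound_def c_def)
  show ?thesis
    unfolding eq c_def[symmetric] using assms False by (simp add: field_simps power2_eq_square)
qed (simp add: rate_bound_def)

context
  fixes \<gamma>max R G \<rho> \<mu> :: real
  assumes pos: "0 < \<gamma>max" "0 < \<mu>" and nonneg: "0 \<le> \<rho>" "0 \<le> G"
begin

text \<open>This step size balances the two terms of the rate bound, which makes it the minimizer
  over all positive step sizes when \<open>R > 0\<close>.\<close>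

lemma unconstrained_stepsize:
  assumes "\<rho> \<noteq> 0" "G \<noteq> 0"
  shows "4 * (\<rho> / \<mu> * G\<^sup>2) * (1 / 2 * sqrt (\<mu> / \<rho>) * (R / G))\<^sup>2 = R\<^sup>2"
  using assms pos nonneg by (simp add: power_mult_distrib power_divide)

lemma optimal_stepsize_bounds:
  assumes "0 < R"
  shows "0 < optimal_stepsize \<gamma>max R G \<rho> \<mu>" "optimal_stepsize \<gamma>max R G \<rho> \<mu> \<le> \<gamma>max"
  using assms pos nonneg by (auto simp: optimal_stepsize_def)

text \<open>Write \<open>b\<close> for the optimal and \<open>u\<close> for the balancing step size.
  Below \<open>b\<close> the product \<open>\<gamma> * b\<close> is less than the square of
  \<open>u\<close>, above \<open>b\<close> it is greater, so both factors of the difference change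
  sign together. If \<open>\<rho> = 0\<close> or \<open>G = 0\<close>, only the term decreasing in
  \<open>\<gamma>\<close> remains.\<close>

lemma rate_bound_optimal_stepsize_less:
  assumes R: "0 < R" and k: "1 \<le> k"
    and \<gamma>: "0 < \<gamma>" "\<gamma> \<le> \<gamma>max" "\<gamma> \<noteq> optimal_stepsize \<gamma>max R G \<rho> \<mu>"
  shows "rate_bound R G \<rho> \<mu> k (optimal_stepsize \<gamma>max R G \<rho> \<mu>) < rate_bound R G \<rho> \<mu> k \<gamma>"
proof -
  define b where "b = optimal_stepsize \<gamma>max R G \<rho> \<mu>"
  define c where "c = 4 * (\<rho> / \<mu> * G\<^sup>2)"
  define u where "u = 1 / 2 * sqrt (\<mu> / \<rho>) * (R / G)"
  have b: "0 < b" "b \<le> \<gamma>max" using optimal_stepsize_bounds[OF R] by (simp_all add: b_def)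
  have c: "0 \<le> c" using pos nonneg by (simp add: c_def)
  have "0 < (b - \<gamma>) * (R\<^sup>2 - c * (\<gamma> * b))"
  proof (cases "\<rho> = 0 \<or> G = 0")
    case True
    then have "b = \<gamma>max" "c = 0" by (auto simp: b_def optimal_stepsize_def c_def)
    then show ?thesis using \<gamma> R by (simp add: b_def)
  next
    case False
    then have bu: "b = min \<gamma>max u" by (simp add: b_def u_def optimal_stepsize_def)
    have cu: "c * u\<^sup>2 = R\<^sup>2"
      using unconstrained_stepsize False by (simp add: c_def u_def)
    have u: "0 < u" using False pos nonneg R by (simp add: u_def)
    have c: "0 < c" using False pos nonneg by (simp add: c_def)
    have eq: "R\<^sup>2 - c * (\<gamma> * b) = c * (u\<^sup>2 - \<gamma> * b)" using cu by (simp add: algebra_simps)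
    show ?thesis
    proof (cases "\<gamma> < b")
      case True
      have "\<gamma> * b < b * b" using True b by simp
      also have "\<dots> \<le> u * u" using b bu by (intro mult_mono) auto
      finally have "\<gamma> * b < u\<^sup>2" by (simp add: power2_eq_square)
      then show ?thesis unfolding eq using True c by simp
    next
      case False
      then have "b < \<gamma>" using \<gamma>(3) by (simp add: b_def)
      \<comment> \<open>An admissible \<open>\<gamma>\<close> above \<open>b\<close> excludes
        \<open>b = \<gamma>max\<close>.\<close>
      then have "b = u" using bu \<gamma>(2) by (auto simp: min_def split: if_splits)
      then have "u\<^sup>2 < \<gamma> * b" using \<open>b < \<gamma>\<close> b by (simp add: power2_eq_square)
      then show ?thesis
        unfolding eq using \<open>b < \<gamma>\<close> c by (simp add: mult_neg_neg mult_pos_neg)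
    qed
  qed
  then have "0 < (b - \<gamma>) * (R\<^sup>2 - c * (\<gamma> * b)) / (real k * 2 * \<gamma> * b)"
    using k \<gamma>(1) b(1) by simp
  also have "\<dots> = rate_bound R G \<rho> \<mu> k \<gamma> - rate_bound R G \<rho> \<mu> k b"
    using rate_bound_diff[OF \<gamma>(1) b(1)] by (simp add: c_def)
  finally show ?thesis by (simp add: b_def)
qed

lemma rate_bound_optimal_stepsize_le:
  assumes "0 \<le> R" "1 \<le> k" "0 < \<gamma>" "\<gamma> \<le> \<gamma>max"
  shows "rate_bound R G \<rho> \<mu> k (optimal_stepsize \<gamma>max R G \<rho> \<mu>) \<le> rate_bound R G \<rho> \<mu> k \<gamma>"
proof (cases "R = 0")
  case True
  \<comment> \<open>With \<open>R = 0\<close> the step size is 0 unless \<open>\<rho>\<close> or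
    \<open>G\<close> vanishes, so the second term is 0 in every case, and the first is 0 even where
    it divides by zero.\<close>
  have "rate_bound 0 G \<rho> \<mu> k (optimal_stepsize \<gamma>max 0 G \<rho> \<mu>) = 0"
    using pos by (auto simp: rate_bound_def optimal_stepsize_def)
  moreover have "0 \<le> rate_bound 0 G \<rho> \<mu> k \<gamma>"
    using assms pos nonneg by (simp add: rate_bound_def)
  ultimately show ?thesis using True by simp
next
  case False
  then show ?thesis
    using rate_bound_optimal_stepsize_less[of k \<gamma>] assms
    by (cases "\<gamma> = optimal_stepsize \<gamma>max R G \<rho> \<mu>") auto
qed

lemma is_arg_min_rate_bound_iff:
  assumes R: "0 < R" and k: "1 \<le> k"
  shows "is_arg_min (rate_bound R G \<rho> \<mu> k) (\<lambda>\<gamma>. 0 < \<gamma> \<and> \<gamma> \<le> \<gamma>max) \<gamma>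
    \<longleftrightarrow> \<gamma> = optimal_stepsize \<gamma>max R G \<rho> \<mu>"
proof
  assume "is_arg_min (rate_bound R G \<rho> \<mu> k) (\<lambda>\<gamma>. 0 < \<gamma> \<and> \<gamma> \<le> \<gamma>max) \<gamma>"
  then show "\<gamma> = optimal_stepsize \<gamma>max R G \<rho> \<mu>"
    using rate_bound_optimal_stepsize_less[OF R k] optimal_stepsize_bounds[OF R]
    unfolding is_arg_min_def by blast
next
  assume "\<gamma> = optimal_stepsize \<gamma>max R G \<rho> \<mu>"
  then show "is_arg_min (rate_bound R G \<rho> \<mu> k) (\<lambda>\<gamma>. 0 < \<gamma> \<and> \<gamma> \<le> \<gamma>max) \<gamma>"
    using rate_bound_optimal_stepsize_le[OF less_imp_le[OF R] k] optimal_stepsize_bounds[OF R]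
    unfolding is_arg_min_def by (metis not_less)
qed

text \<open>Up to the balance point the second term is at most the first, so the bracket is at most
  the square of \<open>R\<close> divided by the step size. Each of the two possible values of the
  minimum then gives one entry of the maximum.\<close>

lemma rate_bound_at_optimal_stepsize:
  assumes R: "0 < R"
  shows "rate_bound R G \<rho> \<mu> k (optimal_stepsize \<gamma>max R G \<rho> \<mu>)
    \<le> 1 / real k * max (R\<^sup>2 / \<gamma>max) (2 * sqrt (\<rho> / \<mu>) * R * G)"
  unfolding rate_bound_def
proof (rule mult_left_mono)
  define b where "b = optimal_stepsize \<gamma>max R G \<rho> \<mu>"
  define c where "c = 4 * (\<rho> / \<mu> * G\<^sup>2)"
  define u where "u = 1 / 2 * sqrt (\<mu> / \<rho>) * (R / G)"
  have b: "0 < b" using optimal_stepsize_bounds[OF R] by (simp add: b_def)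
  have c: "0 \<le> c" using pos nonneg by (simp add: c_def)
  have "1 / (2 * b) * R\<^sup>2 + b * c / 2 \<le> max (R\<^sup>2 / \<gamma>max) (2 * sqrt (\<rho> / \<mu>) * R * G)"
  proof (cases "\<rho> = 0 \<or> G = 0")
    case True
    then have "b = \<gamma>max" "c = 0" by (auto simp: b_def optimal_stepsize_def c_def)
    then have "1 / (2 * b) * R\<^sup>2 + b * c / 2 \<le> R\<^sup>2 / \<gamma>max"
      using pos by (simp add: field_simps)
    then show ?thesis by simp
  next
    case False
    then have bu: "b = min \<gamma>max u" by (simp add: b_def u_def optimal_stepsize_def)
    have cu: "c * u\<^sup>2 = R\<^sup>2"
      using unconstrained_stepsize False by (simp add: c_def u_def)
    have u: "0 < u" using False pos nonneg R by (simp add: u_def)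
    have "c * (b * b) \<le> c * (u * u)"
      using c b bu by (intro mult_left_mono mult_mono) auto
    then have "b * c / 2 \<le> 1 / (2 * b) * R\<^sup>2"
      using b cu by (simp add: field_simps power2_eq_square)
    then have le: "1 / (2 * b) * R\<^sup>2 + b * c / 2 \<le> R\<^sup>2 / b" by simp
    show ?thesis
    proof (cases "b = \<gamma>max")
      case True
      then show ?thesis using le by simp
    next
      case False
      then have "b = u" using bu by (simp add: min_def split: if_splits)
      moreover have "R\<^sup>2 / u = 2 * sqrt (\<rho> / \<mu>) * R * G"
        using \<open>\<not> (\<rho> = 0 \<or> G = 0)\<close> R pos nonneg
        by (simp add: u_def real_sqrt_divide power2_eq_square field_simps)
      ultimately show ?thesis using le by simp
    qed
  qed
  then show "1 / (2 * optimal_stepsize \<gamma>max R G \<rho> \<mu>) * R\<^sup>2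
      + 2 * optimal_stepsize \<gamma>max R G \<rho> \<mu> * (\<rho> / \<mu>) * G\<^sup>2
      \<le> max (R\<^sup>2 / \<gamma>max) (2 * sqrt (\<rho> / \<mu>) * R * G)"
    by (simp add: b_def c_def mult_ac)
qed simp

end

section \<open>Assembly of the rates, with the start at the solution treated apart\<close>

lemma pd_form_pos:
  fixes D :: "real^'m^'m" and X :: "real^'d^'m"
  assumes D: "pd D" and X: "X \<noteq> 0"
  shows "0 < X \<bullet> (D ** X)"
proof -
  have "0 < lambda_min D * (X \<bullet> X)" using lambda_min_pos[OF D] X by simp
  also have "\<dots> \<le> X \<bullet> (D ** X)"
    unfolding inner_matrix_columns column_matrix_mult sum_distrib_left
    using D by (intro sum_mono lambda_min_le_eigenvalue) (simp add: pd_def)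
  finally show ?thesis .
qed

text \<open>For \<open>X0 = Xs\<close> the optimal step size may be the inadmissible value 0, so that the rate bound
  for admissible step sizes does not apply.\<close>

lemma (in abc_matrices) zero_stepsize_from_consensus:
  assumes iter: "ABC_iterates (B ** D) B C f 0 (consensual x) X Y"
  shows "X k = consensual x"
proof -
  have fixed: "D ** consensual x = consensual x" "B ** consensual x = consensual x"
    "C ** consensual x = 0"
    by (simp_all add: matrix_mult_consensual D_one B_one C_one)
       (simp_all add: consensual_def vec_eq_iff)
  have "X k = consensual x \<and> Y k = 0"
    using iter unfolding ABC_iterates_def
    by (induction k) (simp_all add: fixed flip: matrix_mul_assoc)
  then show ?thesis by simp
qed

theorem corollary25:
  fixes f :: "'m::finite \<Rightarrow> real^'d \<Rightarrow> real"
    and A B C D :: "real^'m^'m"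
    and xs :: "real^'d"
    and X0 Xs :: "real^'d^'m"
    and L \<gamma>max \<gamma>opt R G \<rho> \<mu> :: real
  assumes m: "2 \<le> CARD('m)"
    and L: "0 < L"
    and convex: "\<And>i. convex_on UNIV (f i)"
    and smooth: "\<And>i. smooth L (f i)"
    and optimal: "\<And>x. 1 / real CARD('m) * (\<Sum>i\<in>UNIV. f i xs)
                       \<le> 1 / real CARD('m) * (\<Sum>i\<in>UNIV. f i x)"
    and Xs: "Xs = consensual xs"
    and sym: "symmetric_mat B" "symmetric_mat C"
    and ABD: "A = B ** D" "psd B" "pd D"
    and stochastic: "D *v 1 = 1" "1 v* B = 1"
    and C: "psd C" "{v. C *v v = 0} = span {1}"
    and commute: "B ** C = C ** B"
    and contraction: "psd (mat 1 - (1/2) *\<^sub>R C - psd_sqrt B ** D ** psd_sqrt B)"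
    and \<gamma>max: "\<gamma>max = lambda_min D / L"
    and R: "R = weighted_norm D (X0 - Xs)"
    and G: "G = norm (stacked_grad f Xs)"
    and \<rho>: "\<rho> = spectral_radius (B - averaging_mat)"
    and \<mu>: "\<mu> = lambda2 C"
    and \<gamma>opt: "\<gamma>opt = optimal_stepsize \<gamma>max R G \<rho> \<mu>"
  shows
    "(\<forall>\<gamma> X Y k. 0 < \<gamma> \<and> \<gamma> \<le> \<gamma>max \<and> ABC_iterates A B C f \<gamma> X0 X Y \<and> 1 \<le> k
        \<longrightarrow> merit f Xs (running_average X k) \<le> rate_bound R G \<rho> \<mu> k \<gamma>)
     \<and> (\<forall>k\<ge>1. \<forall>\<gamma>. 0 < \<gamma> \<and> \<gamma> \<le> \<gamma>max \<longrightarrow> rate_bound R G \<rho> \<mu> k \<gamma>opt \<le> rate_bound R G \<rho> \<mu> k \<gamma>)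
     \<and> (X0 \<noteq> Xs \<longrightarrow> (\<forall>k\<ge>1. \<forall>\<gamma>.
          is_arg_min (rate_bound R G \<rho> \<mu> k) (\<lambda>\<gamma>. 0 < \<gamma> \<and> \<gamma> \<le> \<gamma>max) \<gamma> \<longleftrightarrow> \<gamma> = \<gamma>opt))
     \<and> (\<forall>X Y k. ABC_iterates A B C f \<gamma>opt X0 X Y \<and> 1 \<le> k
        \<longrightarrow> merit f Xs (running_average X k)
            \<le> 1 / real k * max (L * R\<^sup>2 / lambda_min D) (2 * sqrt (\<rho> / \<mu>) * R * G))"
proof -
  have B_one: "B *v 1 = 1"
    using stochastic(2) sym(1) by (metis symmetric_mat_def transpose_matrix_vector)
  interpret abc: abc_matrices B C D
    using m ABD stochastic C commute contraction B_one by unfold_locales auto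
  have \<rho>_eq: "\<rho> = abc.\<rho>" and \<mu>_eq: "\<mu> = abc.\<mu>"
    by (simp_all add: \<rho> \<mu> abc.\<rho>_def abc.\<mu>_def)
  have \<rho>0: "0 \<le> \<rho>" and \<mu>0: "0 < \<mu>" using abc.\<rho>_nonneg abc.\<mu>_pos \<rho>_eq \<mu>_eq by auto
  have lmin: "0 < lambda_min D" using ABD(3) by (rule lambda_min_pos)
  then have \<gamma>max0: "0 < \<gamma>max" using L \<gamma>max by simp
  have G0: "0 \<le> G" by (simp add: G)
  have form0: "0 \<le> (X0 - Xs) \<bullet> (D ** (X0 - Xs))"
    using pd_form_pos[OF ABD(3), of "X0 - Xs"] by (cases "X0 - Xs = 0") auto
  then have R0: "0 \<le> R" by (simp add: R weighted_norm_eq)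
  have R_pos: "0 < R" if "X0 \<noteq> Xs"
    using pd_form_pos[OF ABD(3), of "X0 - Xs"] that by (simp add: R weighted_norm_eq)
  have opt: "(\<Sum>i\<in>UNIV. f i xs) \<le> (\<Sum>i\<in>UNIV. f i y)" for y
    using optimal[of y] m by (simp add: divide_le_cancel)
  have rate: "merit f Xs (running_average X k) \<le> rate_bound R G \<rho> \<mu> k \<gamma>"
    if "0 < \<gamma>" "\<gamma> \<le> \<gamma>max" "ABC_iterates A B C f \<gamma> X0 X Y" "1 \<le> k" for \<gamma> X Y k
    unfolding R G \<rho>_eq \<mu>_eq
    using that L ABD(1) \<gamma>max
    by (intro abc.merit_le_rate_bound[OF convex smooth opt _ _ Xs]) (auto simp: field_simps)
  have optimal_rate: "merit f Xs (running_average X k)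
      \<le> 1 / real k * max (L * R\<^sup>2 / lambda_min D) (2 * sqrt (\<rho> / \<mu>) * R * G)"
    if iter: "ABC_iterates A B C f \<gamma>opt X0 X Y" and k: "1 \<le> k" for X Y k
  proof -
    have "merit f Xs (running_average X k)
        \<le> 1 / real k * max (R\<^sup>2 / \<gamma>max) (2 * sqrt (\<rho> / \<mu>) * R * G)"
    \<comment> \<open>Step size 0 lies outside the range of \<open>rate\<close>, but there the
      iteration never leaves \<open>Xs\<close> and the merit is 0.\<close>
    proof (cases "X0 = Xs \<and> \<gamma>opt = 0")
      case True
      then have "X t = Xs" for t
        using abc.zero_stepsize_from_consensus[of f xs X Y t] iter ABD(1) Xs by simp
      then have "running_average X k = Xs"
        using k by (simp add: running_average_def sum_constant_scaleR del: sum_constant)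
      moreover have "(mat 1 - averaging_mat) ** Xs = 0"
        by (simp add: Xs matrix_mult_diff_left averaging_mat_mult)
           (simp add: consensual_def vec_eq_iff sum_constant_scaleR del: sum_constant)
      ultimately have "merit f Xs (running_average X k) = 0" by (simp add: merit_def)
      also have "0 \<le> 1 / real k * max (R\<^sup>2 / \<gamma>max) (2 * sqrt (\<rho> / \<mu>) * R * G)"
        using \<gamma>max0 by (simp add: le_max_iff_disj)
      finally show ?thesis .
    next
      case False
      show ?thesis
      proof (cases "X0 = Xs")
        case True
        then have R: "R = 0" by (simp add: R weighted_norm_eq)
        \<comment> \<open>For \<open>R = 0\<close> the balancing step size is 0, so a nonzero
          \<open>\<gamma>opt\<close> can only come from the branch
          \<open>\<rho> = 0 \<or> G = 0\<close>, where the rate bound is 0.\<close>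
        have opt_max: "\<gamma>opt = \<gamma>max"
          using False True R \<gamma>max0 by (auto simp: \<gamma>opt optimal_stepsize_def split: if_splits)
        then have "\<rho> = 0 \<or> G = 0"
          using R \<gamma>max0 by (auto simp: \<gamma>opt optimal_stepsize_def split: if_splits)
        then have "rate_bound R G \<rho> \<mu> k \<gamma>opt = 0" using R by (auto simp: rate_bound_def)
        then have "merit f Xs (running_average X k) \<le> 0"
          using rate[OF _ _ iter k] opt_max \<gamma>max0 by simp
        then show ?thesis using R by simp
      next
        case False
        have "merit f Xs (running_average X k) \<le> rate_bound R G \<rho> \<mu> k \<gamma>opt"
          using rate[OF _ _ iter k] optimal_stepsize_bounds[OF \<gamma>max0 \<mu>0 \<rho>0 G0 R_pos[OF False]]
          by (simp add: \<gamma>opt)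
        also have "\<dots> \<le> 1 / real k * max (R\<^sup>2 / \<gamma>max) (2 * sqrt (\<rho> / \<mu>) * R * G)"
          unfolding \<gamma>opt
          by (rule rate_bound_at_optimal_stepsize[OF \<gamma>max0 \<mu>0 \<rho>0 G0 R_pos[OF False]])
        finally show ?thesis .
      qed
    qed
    then show ?thesis by (simp add: \<gamma>max mult.commute)
  qed
  show ?thesis
    using rate optimal_rate
      rate_bound_optimal_stepsize_le[OF \<gamma>max0 \<mu>0 \<rho>0 G0 R0]
      is_arg_min_rate_bound_iff[OF \<gamma>max0 \<mu>0 \<rho>0 G0 R_pos]
    unfolding \<gamma>opt by blast
qed

end
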